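(* Assume Model M (described in the context), and suppose that $B_n=B_n(\bar X_2)$ is a sequence of random real symmetric $n\times n$ matrices, each a (measurable) function of $\bar X_2$, for which $\|B_n\|$ is $O_{\rm a.s.}(1)$. Then, as $p,n\to\infty$ with $p/n\to\gamma>0$, $$n^{-1}\bar X_1B_n(\bar X_2)\bar X_1^T-\big(n^{-1}\mathrm{tr}\,B_n(\bar X_2)\big)\,\Gamma\to0\quad\text{almost surely}.$$
   Context: Model M. Let $m$ be fixed and let $x=[\xi^T,\eta^T]^T\in\mathbb R^{m+p}$ be a random vector whose entries have finite $(4+\delta)$th moment for some $\delta>0$. Here $\xi\in\mathbb R^m$ has mean zero and covariance $\Sigma$ and is independent of $\eta\in\mathbb R^p$, whose components $\eta_i$ are i.i.d. with mean zero and variance one (the laws of $\xi$ and of $\eta_i$ do not depend on $n,p$). Let $\Sigma_D=\mathrm{diag}(\sigma_1^2,\dots,\sigma_m^2)$ contain the variances of $\xi_1,\dots,\xi_m$, and let $\Gamma=\Sigma_D^{-1/2}\Sigma\Sigma_D^{-1/2}$ be the correlation matrix of $\xi$, with eigenvalues $\ell_1\ge\dots\ge\ell_m>0$. One has a sequence of i.i.d. copies of $x$, the first $n$ of which are the columns of the $(m+p)\times n$ data matrix $X$ (for varying $p=p(n)$, all data matrices come from one array: i.i.d. copies of $(\xi,\eta_1,\eta_2,\dots)$ on one probability space). The asymptotic regime is $m$ fixed, $p,n\to\infty$, $\gamma_n=p/n\to\gamma>0$. Write $X=[X_1^T,X_2^T]^T$ with $X_1\in\mathbb R^{m\times n}$,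 $X_2\in\mathbb R^{p\times n}$. Let $S_{D1}$ and $S_{D2}$ be the diagonal parts of $n^{-1}X_1X_1^T$ and $n^{-1}X_2X_2^T$, and put $\bar X_1=S_{D1}^{-1/2}X_1$, $\bar X_2=S_{D2}^{-1/2}X_2$ (rows that vanish identically are left as zero). $\|\cdot\|$ is the spectral norm; $\|B_n\|=O_{\rm a.s.}(1)$ means that almost surely $\limsup_n\|B_n\|<\infty$. *)

theory Defs
  imports
    "HOL-Probability.Probability"
    "Jordan_Normal_Form.Char_Poly"
begin

text \<open>
  The dimensions of the matrices grow along the asymptotic regime, so matrices are the
  carrier-based \<open>real mat\<close>. Clashes with the fixed-dimension notions of
  HOL-Analysis (\<open>mat\<close>, \<open>trace\<close>, \<open>transpose\<close>) are resolved by qualified or long names.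
\<close>

definition mat_trace :: "real mat \<Rightarrow> real" where
  "mat_trace A = (\<Sum>i<dim_row A. A $$ (i, i))"

definition euclid_norm :: "real vec \<Rightarrow> real" where
  "euclid_norm v = sqrt (scalar_prod v v)"

definition spectral_norm :: "real mat \<Rightarrow> real" where
  "spectral_norm A =
     (SUP v\<in>{v \<in> carrier_vec (dim_col A). euclid_norm v \<le> 1}. euclid_norm (A *\<^sub>v v))"

definition diag_part :: "real mat \<Rightarrow> real mat" where
  "diag_part A =
     Matrix.mat (dim_row A) (dim_row A) (\<lambda>(i, j). if i = j then A $$ (i, i) else 0)"

text \<open>
  The power $-1/2$ of the diagonal part of \<open>A\<close>. Since \<open>1 / sqrt 0 = 0\<close>, a zero on
  the diagonal stays zero; in \<open>normalized_rows\<close> this leaves identically vanishing rows zero.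
\<close>
definition diag_inv_sqrt :: "real mat \<Rightarrow> real mat" where
  "diag_inv_sqrt A =
     Matrix.mat (dim_row A) (dim_row A) (\<lambda>(i, j). if i = j then 1 / sqrt (A $$ (i, i)) else 0)"

definition normalized_rows :: "real mat \<Rightarrow> real mat" where
  "normalized_rows X =
     diag_inv_sqrt (diag_part ((1 / real (dim_col X)) \<cdot>\<^sub>m (X * transpose_mat X))) * X"

definition covariance_matrix :: "'a measure \<Rightarrow> nat \<Rightarrow> ('a \<Rightarrow> nat \<Rightarrow> real) \<Rightarrow> real mat" where
  "covariance_matrix M m \<xi> = Matrix.mat m m (\<lambda>(i, j).
     (\<integral>\<omega>. (\<xi> \<omega> i - (\<integral>\<omega>'. \<xi> \<omega>' i \<partial>M)) * (\<xi> \<omega> j - (\<integral>\<omega>'. \<xi> \<omega>' j \<partial>M)) \<partial>M))"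

definition correlation_matrix :: "'a measure \<Rightarrow> nat \<Rightarrow> ('a \<Rightarrow> nat \<Rightarrow> real) \<Rightarrow> real mat" where
  "correlation_matrix M m \<xi> =
     (let \<Sigma> = covariance_matrix M m \<xi>; \<Sigma>\<^sub>D = diag_part \<Sigma>
      in diag_inv_sqrt \<Sigma>\<^sub>D * \<Sigma> * diag_inv_sqrt \<Sigma>\<^sub>D)"

text \<open>
  \<open>\<xi> j\<close> and \<open>\<eta> j\<close> form the \<open>j\<close>-th i.i.d. copy of $(\xi, \eta_1, \eta_2, \dots)$; all indices
  start at 0. A vector in $\mathbb R^m$ is an extensional function on \<open>{..<m}\<close>, that is, a point of
  \<open>Pi\<^sub>M {..<m} (\<lambda>_. borel)\<close>. A vanishing variance of some $\xi_i$ would give \<open>correlation_matrix\<close> a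
  zero row, hence the eigenvalue 0, and is therefore excluded by the last assumption.
\<close>
locale spiked_array = prob_space M
  for M :: "'a measure" +
  fixes m :: nat
    and \<delta> :: real
    and \<xi> :: "nat \<Rightarrow> 'a \<Rightarrow> nat \<Rightarrow> real"
    and \<eta> :: "nat \<Rightarrow> 'a \<Rightarrow> nat \<Rightarrow> real"
  assumes delta_pos: "\<delta> > 0"
    and columns_indep:
      "indep_vars (\<lambda>_. Pi\<^sub>M {..<m} (\<lambda>_. borel) \<Otimes>\<^sub>M Pi\<^sub>M UNIV (\<lambda>_. borel))
         (\<lambda>j \<omega>. (\<xi> j \<omega>, \<eta> j \<omega>)) UNIV"
    and columns_ident:
      "\<And>j. distr M (Pi\<^sub>M {..<m} (\<lambda>_. borel) \<Otimes>\<^sub>M Pi\<^sub>M UNIV (\<lambda>_. borel)) (\<lambda>\<omega>. (\<xi> j \<omega>, \<eta> j \<omega>)) =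
           distr M (Pi\<^sub>M {..<m} (\<lambda>_. borel) \<Otimes>\<^sub>M Pi\<^sub>M UNIV (\<lambda>_. borel)) (\<lambda>\<omega>. (\<xi> 0 \<omega>, \<eta> 0 \<omega>))"
    and xi_eta_indep:
      "indep_var (Pi\<^sub>M {..<m} (\<lambda>_. borel)) (\<xi> 0) (Pi\<^sub>M UNIV (\<lambda>_. borel)) (\<eta> 0)"
    and eta_indep: "indep_vars (\<lambda>_. borel) (\<lambda>i \<omega>. \<eta> 0 \<omega> i) UNIV"
    and eta_ident: "\<And>i. distr M borel (\<lambda>\<omega>. \<eta> 0 \<omega> i) = distr M borel (\<lambda>\<omega>. \<eta> 0 \<omega> 0)"
    and xi_moment: "\<And>i. i < m \<Longrightarrow> integrable M (\<lambda>\<omega>. \<bar>\<xi> 0 \<omega> i\<bar> powr (4 + \<delta>))"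
    and eta_moment: "\<And>i. integrable M (\<lambda>\<omega>. \<bar>\<eta> 0 \<omega> i\<bar> powr (4 + \<delta>))"
    and xi_mean: "\<And>i. i < m \<Longrightarrow> expectation (\<lambda>\<omega>. \<xi> 0 \<omega> i) = 0"
    and eta_mean: "\<And>i. expectation (\<lambda>\<omega>. \<eta> 0 \<omega> i) = 0"
    and eta_variance: "\<And>i. variance (\<lambda>\<omega>. \<eta> 0 \<omega> i) = 1"
    and corr_eigenvalues_pos:
      "\<And>l. eigenvalue (correlation_matrix M m (\<xi> 0)) l \<Longrightarrow> l > 0"

text \<open>The \<open>k \<times> n\<close> matrix whose columns are the first \<open>n\<close> copies, truncated to \<open>k\<close> coordinates.\<close>
definition data_matrix :: "(nat \<Rightarrow> 'a \<Rightarrow> nat \<Rightarrow> real) \<Rightarrow> nat \<Rightarrow> nat \<Rightarrow> 'a \<Rightarrow> real mat" where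
  "data_matrix z k n \<omega> = Matrix.mat k n (\<lambda>(i, j). z j \<omega> i)"

end

theory Submission
  imports Defs
begin

text \<open>
  The entry \<open>(i, j)\<close> of $n^{-1} \bar X_1 B_n \bar X_1^T$ is the bilinear form
  $n^{-1} \sum_{k,l} (B_n)_{kl} \xi_{ki} \xi_{lj}$, divided by the empirical standard deviations of
  the rows \<open>i\<close> and \<open>j\<close>. The weights $B_n$ depend on the \<open>\<eta>\<close>-array only, which is independent of the
  \<open>\<xi>\<close>-array (\<open>indep_component_sequences\<close>), so by Fubini a moment bound that is uniform over
  deterministic weights carries over to them (\<open>nn_integral_bound_of_indep\<close>). Since $B_n$ is symmetric,
  polarisation reduces the bilinear form to quadratic forms $y^T B_n y$ in one centred i.i.d. sequence
  $y_k = \xi_{ki} \pm \xi_{kj}$. These are handled in \<open>quadratic_form_strong_law\<close> by splitting off the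
  diagonal; \<open>K\<close> bounds the sums of squares of the columns of $B_n$.

  Off the diagonal, the fourth moment of $\sum_{k<l} 2 (B_n)_{kl} y_k y_l$ is $O(n^2)$
  (\<open>triangular_quadratic_form_fourth_moment\<close>): the two indices of each summand differ, so no variable
  occurs in the fourth power of the sum with an exponent above four. After division by $n^4$ these
  bounds are summable, which forces almost sure convergence to 0 (\<open>AE_tendsto_0_of_fourth_moments\<close>).
  On the diagonal, for fixed weights, $\sum_k (B_n)_{kk} (y_k^2 - E y_k^2)$ has independent square integrable summands
  (\<open>weighted_strong_law\<close>). Truncating the \<open>k\<close>-th variable at level $\sqrt{k+1}$ keeps the fourth
  moments of the sums $O(n^2)$, changes almost surely only finitely many variables, and moves the
  \<open>k\<close>-th mean by no more than $O(k^{-1/2})$.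

  The almost sure bound on $\|B_n\|$ may be random. The spectral norm dominates the Euclidean norm of
  every column, so the matrix $B_n^{(K)}$, equal to $B_n$ where all column square sums are at most \<open>K\<close>
  and to 0 elsewhere, agrees with $B_n$ for large \<open>n\<close> almost surely once \<open>K\<close> is large; the limit
  theorem is applied to $B_n^{(K)}$ for every natural \<open>K\<close>. The identity matrix as weights shows that the
  empirical variances of the rows converge to the true ones, and these are positive because otherwise
  \<open>\<Gamma>\<close> would have a zero column and hence the eigenvalue 0.
\<close>

section \<open>Fourth moments of sums and of triangular quadratic forms\<close>

lemma monomial_le_fourth_powers:
  fixes a b :: real
  assumes "i + j \<le> 4"
  shows "\<bar>a ^ i * b ^ j\<bar> \<le> 1 + a ^ 4 + b ^ 4"
proof -
  define c where "c = max 1 (max \<bar>a\<bar> \<bar>b\<bar>)"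
  have c: "1 \<le> c" "\<bar>a\<bar> \<le> c" "\<bar>b\<bar> \<le> c"
    unfolding c_def by auto
  have "\<bar>a ^ i * b ^ j\<bar> = \<bar>a\<bar> ^ i * \<bar>b\<bar> ^ j"
    by (simp add: abs_mult power_abs)
  also have "\<dots> \<le> c ^ i * c ^ j"
    using c by (intro mult_mono power_mono) auto
  also have "\<dots> = c ^ (i + j)"
    by (simp add: power_add)
  also have "\<dots> \<le> c ^ 4"
    using assms c by (intro power_increasing) auto
  also have "\<dots> \<le> 1 + a ^ 4 + b ^ 4"
    unfolding c_def max_def by (auto simp: power_even_abs)
  finally show ?thesis .
qed

context prob_space
begin

lemma integrable_monomial_of_fourth:
  fixes S T :: "'a \<Rightarrow> real"
  assumes [measurable]: "S \<in> borel_measurable M" "T \<in> borel_measurable M"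
    and int: "integrable M (\<lambda>\<omega>. S \<omega> ^ 4)" "integrable M (\<lambda>\<omega>. T \<omega> ^ 4)"
    and "i + j \<le> 4"
  shows "integrable M (\<lambda>\<omega>. S \<omega> ^ i * T \<omega> ^ j)"
proof (rule Bochner_Integration.integrable_bound)
  show "integrable M (\<lambda>\<omega>. 1 + S \<omega> ^ 4 + T \<omega> ^ 4)"
    using int by simp
  show "AE \<omega> in M. norm (S \<omega> ^ i * T \<omega> ^ j) \<le> norm (1 + S \<omega> ^ 4 + T \<omega> ^ 4)"
    using monomial_le_fourth_powers[OF assms(5)]
    by (intro always_eventually allI) (auto intro: order_trans)
qed measurable

lemma integrable_power_of_fourth:
  fixes S :: "'a \<Rightarrow> real"
  assumes "S \<in> borel_measurable M" "integrable M (\<lambda>\<omega>. S \<omega> ^ 4)" "i \<le> 4"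
  shows "integrable M (\<lambda>\<omega>. S \<omega> ^ i)"
  using integrable_monomial_of_fourth[OF assms(1) assms(1) assms(2) assms(2), of i 0] assms(3)
  by simp

text \<open>
  Both kinds of fourth moment below grow by adding a fresh centred variable \<open>X\<close>, times a coefficient
  \<open>D\<close> from the past, to a sum \<open>S\<close> from the past. The term of first order in \<open>X\<close> has expectation 0 by
  independence; the one of third order need not, as \<open>D\<close> and \<open>S\<close> may be correlated.
\<close>
lemma fourth_moment_step:
  fixes X D S :: "'a \<Rightarrow> real"
  assumes indep: "\<And>i j l. indep_var borel (\<lambda>\<omega>. X \<omega> ^ i) borel (\<lambda>\<omega>. D \<omega> ^ j * S \<omega> ^ l)"
    and X4: "integrable M (\<lambda>\<omega>. X \<omega> ^ 4)" and D4: "integrable M (\<lambda>\<omega>. D \<omega> ^ 4)"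
    and S4: "integrable M (\<lambda>\<omega>. S \<omega> ^ 4)" and mean: "expectation X = 0"
  shows "integrable M (\<lambda>\<omega>. (S \<omega> + X \<omega> * D \<omega>) ^ 4)"
    and "expectation (\<lambda>\<omega>. (S \<omega> + X \<omega> * D \<omega>) ^ 4) \<le> expectation (\<lambda>\<omega>. S \<omega> ^ 4)
      + 8 * expectation (\<lambda>\<omega>. X \<omega> ^ 2) * expectation (\<lambda>\<omega>. D \<omega> ^ 2 * S \<omega> ^ 2)
      + 3 * expectation (\<lambda>\<omega>. X \<omega> ^ 4) * expectation (\<lambda>\<omega>. D \<omega> ^ 4)"
proof -
  have [measurable]: "X \<in> borel_measurable M" "D \<in> borel_measurable M" "S \<in> borel_measurable M"
    using indep_var_rv1[OF indep[of 1 1 0]] indep_var_rv2[OF indep[of 1 1 0]]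
      indep_var_rv2[OF indep[of 1 0 1]] by simp_all
  let ?T = "\<lambda>\<omega>. X \<omega> * D \<omega>"
  have split: "expectation (\<lambda>\<omega>. X \<omega> ^ i * (D \<omega> ^ j * S \<omega> ^ l))
      = expectation (\<lambda>\<omega>. X \<omega> ^ i) * expectation (\<lambda>\<omega>. D \<omega> ^ j * S \<omega> ^ l)"
    and split_int: "integrable M (\<lambda>\<omega>. X \<omega> ^ i * (D \<omega> ^ j * S \<omega> ^ l))"
    if "i \<le> 4" "j + l \<le> 4" for i j l
    using that indep_var_lebesgue_integral[OF indep, of i j l] indep_var_integrable[OF indep, of i j l]
      integrable_power_of_fourth[OF _ X4, of i] integrable_monomial_of_fourth[OF _ _ D4 S4, of j l]
    by auto
  have T4: "integrable M (\<lambda>\<omega>. ?T \<omega> ^ 4)"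
    using split_int[of 4 4 0] by (simp add: power_mult_distrib)
  have int: "integrable M (\<lambda>\<omega>. S \<omega> ^ i * ?T \<omega> ^ j)" if "i + j \<le> 4" for i j
    by (intro integrable_monomial_of_fourth S4 T4 that) measurable
  have expand: "(S \<omega> + ?T \<omega>) ^ 4 = S \<omega> ^ 4 + 4 * (S \<omega> ^ 3 * ?T \<omega> ^ 1)
      + 6 * (S \<omega> ^ 2 * ?T \<omega> ^ 2) + 4 * (S \<omega> ^ 1 * ?T \<omega> ^ 3) + ?T \<omega> ^ 4" for \<omega>
    by (simp add: algebra_simps power_numeral_reduce)
  show "integrable M (\<lambda>\<omega>. (S \<omega> + ?T \<omega>) ^ 4)"
    unfolding expand using S4 T4
    by (intro Bochner_Integration.integrable_add integrable_mult_right int) auto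
  (* The term of third order in X is absorbed by the even ones, since 2 S T <= S^2 + T^2. *)
  have pointwise: "(S \<omega> + ?T \<omega>) ^ 4
      \<le> S \<omega> ^ 4 + 4 * (S \<omega> ^ 3 * ?T \<omega> ^ 1) + 8 * (S \<omega> ^ 2 * ?T \<omega> ^ 2) + 3 * ?T \<omega> ^ 4" for \<omega>
  proof -
    have "0 \<le> 2 * (?T \<omega> ^ 2 * (S \<omega> - ?T \<omega>) ^ 2)"
      by simp
    also have "\<dots> = S \<omega> ^ 4 + 4 * (S \<omega> ^ 3 * ?T \<omega> ^ 1) + 8 * (S \<omega> ^ 2 * ?T \<omega> ^ 2) + 3 * ?T \<omega> ^ 4
        - (S \<omega> + ?T \<omega>) ^ 4"
      unfolding expand by (simp add: algebra_simps power_numeral_reduce)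
    finally show ?thesis by simp
  qed
  have "expectation (\<lambda>\<omega>. (S \<omega> + ?T \<omega>) ^ 4) \<le> expectation (\<lambda>\<omega>. S \<omega> ^ 4
      + 4 * (S \<omega> ^ 3 * ?T \<omega> ^ 1) + 8 * (S \<omega> ^ 2 * ?T \<omega> ^ 2) + 3 * ?T \<omega> ^ 4)"
    using S4 T4 pointwise \<open>integrable M (\<lambda>\<omega>. (S \<omega> + ?T \<omega>) ^ 4)\<close>
    by (intro integral_mono Bochner_Integration.integrable_add integrable_mult_right int) auto
  also have "\<dots> = expectation (\<lambda>\<omega>. S \<omega> ^ 4) + 4 * expectation (\<lambda>\<omega>. S \<omega> ^ 3 * ?T \<omega> ^ 1)
      + 8 * expectation (\<lambda>\<omega>. S \<omega> ^ 2 * ?T \<omega> ^ 2) + 3 * expectation (\<lambda>\<omega>. ?T \<omega> ^ 4)"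
    using S4 T4 int[of 3 1] int[of 2 2] by simp
  also have "expectation (\<lambda>\<omega>. S \<omega> ^ 3 * ?T \<omega> ^ 1) = 0"
    using split[of 1 1 3] mean by (simp add: mult_ac)
  also have "expectation (\<lambda>\<omega>. S \<omega> ^ 2 * ?T \<omega> ^ 2)
      = expectation (\<lambda>\<omega>. X \<omega> ^ 2) * expectation (\<lambda>\<omega>. D \<omega> ^ 2 * S \<omega> ^ 2)"
    using split[of 2 2 2] by (simp add: power_mult_distrib mult_ac)
  also have "expectation (\<lambda>\<omega>. ?T \<omega> ^ 4) = expectation (\<lambda>\<omega>. X \<omega> ^ 4) * expectation (\<lambda>\<omega>. D \<omega> ^ 4)"
    using split[of 4 4 0] by (simp add: power_mult_distrib)
  finally show "expectation (\<lambda>\<omega>. (S \<omega> + ?T \<omega>) ^ 4) \<le> expectation (\<lambda>\<omega>. S \<omega> ^ 4)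
      + 8 * expectation (\<lambda>\<omega>. X \<omega> ^ 2) * expectation (\<lambda>\<omega>. D \<omega> ^ 2 * S \<omega> ^ 2)
      + 3 * expectation (\<lambda>\<omega>. X \<omega> ^ 4) * expectation (\<lambda>\<omega>. D \<omega> ^ 4)"
    by simp
qed

text \<open>
  The hypothesis \<open>past\<close> makes \<open>s\<close> a function of the coordinates below \<open>n\<close>, so that sums over
  \<open>{..<n}\<close> need not be written in terms of restricted functions.
\<close>
lemma indep_var_next_past:
  fixes y :: "nat \<Rightarrow> 'a \<Rightarrow> real" and f :: "real \<Rightarrow> real" and s :: "(nat \<Rightarrow> real) \<Rightarrow> real"
  assumes indep: "indep_vars (\<lambda>_. borel) y UNIV"
    and [measurable]: "f \<in> borel_measurable borel" "s \<in> borel_measurable (Pi\<^sub>M {..<n} (\<lambda>_. borel))"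
    and past: "\<And>u v. (\<And>k. k < n \<Longrightarrow> u k = v k) \<Longrightarrow> s u = s v"
  shows "indep_var borel (\<lambda>\<omega>. f (y n \<omega>)) borel (\<lambda>\<omega>. s (\<lambda>k. y k \<omega>))"
proof -
  have "indep_var borel ((\<lambda>u. f (u n)) \<circ> (\<lambda>\<omega>. restrict (\<lambda>k. y k \<omega>) {n}))
      borel (s \<circ> (\<lambda>\<omega>. restrict (\<lambda>k. y k \<omega>) {..<n}))"
    by (rule indep_var_compose[OF indep_var_restrict[OF indep]]) auto
  also have "(\<lambda>u. f (u n)) \<circ> (\<lambda>\<omega>. restrict (\<lambda>k. y k \<omega>) {n}) = (\<lambda>\<omega>. f (y n \<omega>))"
    by auto
  also have "s \<circ> (\<lambda>\<omega>. restrict (\<lambda>k. y k \<omega>) {..<n}) = (\<lambda>\<omega>. s (\<lambda>k. y k \<omega>))"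
    by (auto simp: fun_eq_iff intro!: past)
  finally show ?thesis .
qed

text \<open>
  Rosenthal's inequality for the exponent four: this is \<open>fourth_moment_step\<close> with \<open>D = 1\<close>, where the
  mixed moment is the second moment of the partial sum, which is additive.
\<close>
lemma sum_of_independent_moments:
  fixes X :: "nat \<Rightarrow> 'a \<Rightarrow> real"
  assumes indep: "indep_vars (\<lambda>_. borel) X UNIV"
    and X4: "\<And>k. integrable M (\<lambda>\<omega>. X k \<omega> ^ 4)" and mean: "\<And>k. expectation (X k) = 0"
  defines "E2 \<equiv> \<lambda>k. expectation (\<lambda>\<omega>. X k \<omega> ^ 2)" and "E4 \<equiv> \<lambda>k. expectation (\<lambda>\<omega>. X k \<omega> ^ 4)"
  shows "integrable M (\<lambda>\<omega>. (\<Sum>k<n. X k \<omega>) ^ 4)"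
    and "expectation (\<lambda>\<omega>. (\<Sum>k<n. X k \<omega>) ^ 2) = (\<Sum>k<n. E2 k)"
    and "expectation (\<lambda>\<omega>. (\<Sum>k<n. X k \<omega>) ^ 4) \<le> 4 * (\<Sum>k<n. E2 k) ^ 2 + 3 * (\<Sum>k<n. E4 k)"
proof -
  have [measurable]: "X k \<in> borel_measurable M" for k
    using indep by (auto simp: indep_vars_def)
  have E2: "0 \<le> E2 k" for k
    unfolding E2_def by simp
  have "integrable M (\<lambda>\<omega>. (\<Sum>k<n. X k \<omega>) ^ 4)
    \<and> expectation (\<lambda>\<omega>. (\<Sum>k<n. X k \<omega>) ^ 2) = (\<Sum>k<n. E2 k)
    \<and> expectation (\<lambda>\<omega>. (\<Sum>k<n. X k \<omega>) ^ 4) \<le> 4 * (\<Sum>k<n. E2 k) ^ 2 + 3 * (\<Sum>k<n. E4 k)"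
  proof (induction n)
    case 0
    then show ?case by simp
  next
    case (Suc n)
    let ?S = "\<lambda>\<omega>. \<Sum>k<n. X k \<omega>"
    have S4: "integrable M (\<lambda>\<omega>. ?S \<omega> ^ 4)"
      and S2: "expectation (\<lambda>\<omega>. ?S \<omega> ^ 2) = (\<Sum>k<n. E2 k)"
      and IH: "expectation (\<lambda>\<omega>. ?S \<omega> ^ 4) \<le> 4 * (\<Sum>k<n. E2 k) ^ 2 + 3 * (\<Sum>k<n. E4 k)"
      using Suc by auto
    have ind: "indep_var borel (\<lambda>\<omega>. X n \<omega> ^ i) borel (\<lambda>\<omega>. 1 ^ j * ?S \<omega> ^ l)" for i j l
      using indep_var_next_past[OF indep, of "\<lambda>x. x ^ i" "\<lambda>u. 1 ^ j * (\<Sum>k<n. u k) ^ l" n] by simp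
    note step = fourth_moment_step[OF ind X4 _ S4 mean]
    have int: "integrable M (\<lambda>\<omega>. ?S \<omega> ^ i * X n \<omega> ^ j)" if "i + j \<le> 4" for i j
      by (intro integrable_monomial_of_fourth S4 X4 that) measurable
    have int4: "integrable M (\<lambda>\<omega>. (\<Sum>k<Suc n. X k \<omega>) ^ 4)"
      using step(1) by simp
    have "expectation (\<lambda>\<omega>. X n \<omega> ^ 1 * (1 ^ 0 * ?S \<omega> ^ 1)) = 0"
      using indep_var_lebesgue_integral[OF ind[of 1 0 1]] int[of 1 0] int[of 0 1] mean[of n] by simp
    then have "expectation (\<lambda>\<omega>. ?S \<omega> ^ 2 + 2 * (?S \<omega> * X n \<omega>) + X n \<omega> ^ 2) = (\<Sum>k<n. E2 k) + E2 n"
      using int[of 2 0] int[of 0 2] int[of 1 1] S2 by (simp add: E2_def mult.commute)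
    then have sq: "expectation (\<lambda>\<omega>. (\<Sum>k<Suc n. X k \<omega>) ^ 2) = (\<Sum>k<Suc n. E2 k)"
      by (simp add: power2_sum mult.assoc algebra_simps)
    have "expectation (\<lambda>\<omega>. (\<Sum>k<Suc n. X k \<omega>) ^ 4)
        \<le> expectation (\<lambda>\<omega>. ?S \<omega> ^ 4) + 8 * E2 n * (\<Sum>k<n. E2 k) + 3 * E4 n"
      using step(2) S2 by (simp add: E2_def E4_def prob_space)
    also have "\<dots> \<le> 4 * (\<Sum>k<n. E2 k) ^ 2 + 3 * (\<Sum>k<n. E4 k) + 8 * E2 n * (\<Sum>k<n. E2 k)
        + 4 * E2 n ^ 2 + 3 * E4 n"
      using IH zero_le_power2[of "E2 n"] by linarith
    also have "\<dots> = 4 * (\<Sum>k<Suc n. E2 k) ^ 2 + 3 * (\<Sum>k<Suc n. E4 k)"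
      by (simp add: power2_sum algebra_simps)
    finally show ?case
      using int4 sq by blast
  qed
  then show "integrable M (\<lambda>\<omega>. (\<Sum>k<n. X k \<omega>) ^ 4)"
    and "expectation (\<lambda>\<omega>. (\<Sum>k<n. X k \<omega>) ^ 2) = (\<Sum>k<n. E2 k)"
    and "expectation (\<lambda>\<omega>. (\<Sum>k<n. X k \<omega>) ^ 4) \<le> 4 * (\<Sum>k<n. E2 k) ^ 2 + 3 * (\<Sum>k<n. E4 k)"
    by auto
qed

text \<open>
  Row \<open>l\<close> of the form is the fresh variable \<open>y l\<close> times a linear form \<open>D l\<close> in the past, to which
  \<open>fourth_moment_step\<close> applies. The fourth moment of \<open>D l\<close> is $O(e^2)$ by Rosenthal, and an
  increment of order \<open>n e\<^sup>2\<close> in every step adds up to $O(n^2 e^2)$.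
\<close>
lemma triangular_quadratic_form_fourth_moment:
  fixes y :: "nat \<Rightarrow> 'a \<Rightarrow> real" and c :: "nat \<Rightarrow> nat \<Rightarrow> real"
  assumes indep: "indep_vars (\<lambda>_. borel) y UNIV"
    and y4: "\<And>k. integrable M (\<lambda>\<omega>. y k \<omega> ^ 4)" and mean: "\<And>k. expectation (y k) = 0"
    and v: "\<And>k. expectation (\<lambda>\<omega>. y k \<omega> ^ 2) \<le> v"
    and \<kappa>: "\<And>k. expectation (\<lambda>\<omega>. y k \<omega> ^ 4) \<le> \<kappa>"
    and c: "\<And>l. l < n \<Longrightarrow> (\<Sum>k<l. c k l ^ 2) \<le> e"
  defines "C \<equiv> (4 * v * (4 * v + 1) + 3 * \<kappa>) * (4 * v\<^sup>2 + 3 * \<kappa>)"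
  shows "integrable M (\<lambda>\<omega>. (\<Sum>l<n. y l \<omega> * (\<Sum>k<l. c k l * y k \<omega>)) ^ 4)"
    and "expectation (\<lambda>\<omega>. (\<Sum>l<n. y l \<omega> * (\<Sum>k<l. c k l * y k \<omega>)) ^ 4) \<le> C * e\<^sup>2 * (real n)\<^sup>2"
proof -
  have [measurable]: "y k \<in> borel_measurable M" for k
    using indep by (auto simp: indep_vars_def)
  have v0: "0 \<le> v" and \<kappa>0: "0 \<le> \<kappa>"
    using order_trans[OF _ v[of 0]] order_trans[OF _ \<kappa>[of 0]] by auto
  define A where "A = 4 * v\<^sup>2 + 3 * \<kappa>"
  define t where "t = 4 * v + 1"
  have A0: "0 \<le> A" and t1: "1 \<le> t" "4 * v \<le> t"
    using v0 \<kappa>0 by (auto simp: A_def t_def)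
  have C_eq: "C = 4 * v * t * A + 3 * \<kappa> * A"
    unfolding C_def A_def t_def by (simp add: algebra_simps)
  have C0: "0 \<le> C"
    using v0 \<kappa>0 A0 t1 unfolding C_eq by simp
  let ?D = "\<lambda>l \<omega>. \<Sum>k<l. c k l * y k \<omega>"
  have D: "integrable M (\<lambda>\<omega>. ?D l \<omega> ^ 4) \<and> expectation (\<lambda>\<omega>. ?D l \<omega> ^ 4) \<le> A * e\<^sup>2" if "l < n" for l
  proof -
    have ind: "indep_vars (\<lambda>_. borel) (\<lambda>k \<omega>. c k l * y k \<omega>) UNIV"
      by (rule indep_vars_compose2[OF indep]) auto
    have int4: "integrable M (\<lambda>\<omega>. (c k l * y k \<omega>) ^ 4)" for k
      using y4[of k] by (simp add: power_mult_distrib)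
    have mean': "expectation (\<lambda>\<omega>. c k l * y k \<omega>) = 0" for k
      using mean[of k] by simp
    note ros = sum_of_independent_moments[OF ind int4 mean', of l]
    have le: "(\<Sum>k<l. c k l ^ 4) \<le> (\<Sum>k<l. c k l ^ 2)\<^sup>2"
    proof -
      have "(\<Sum>k<l. (c k l ^ 2) ^ 2) \<le> (\<Sum>k<l. c k l ^ 2) ^ 2"
        unfolding power2_eq_square[of "sum _ _"] sum_distrib_left
      proof (intro sum_mono)
        fix k assume "k \<in> {..<l}"
        then have "c k l ^ 2 \<le> (\<Sum>k<l. c k l ^ 2)"
          by (intro member_le_sum) auto
        then show "(c k l ^ 2) ^ 2 \<le> (\<Sum>k<l. c k l ^ 2) * c k l ^ 2"
          unfolding power2_eq_square[of "c k l ^ 2"] by (intro mult_right_mono) auto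
      qed
      then show ?thesis
        by (simp add: power_mult[symmetric])
    qed
    have e: "(\<Sum>k<l. c k l ^ 2)\<^sup>2 \<le> e\<^sup>2"
      using c[OF that] by (intro power_mono) (auto intro: sum_nonneg)
    have "(\<Sum>k<l. expectation (\<lambda>\<omega>. (c k l * y k \<omega>) ^ 2)) \<le> (\<Sum>k<l. c k l ^ 2 * v)"
      by (intro sum_mono) (auto simp: power_mult_distrib intro!: mult_left_mono v)
    then have s2: "(\<Sum>k<l. expectation (\<lambda>\<omega>. (c k l * y k \<omega>) ^ 2))\<^sup>2 \<le> (v * (\<Sum>k<l. c k l ^ 2))\<^sup>2"
      by (intro power_mono sum_nonneg) (auto simp: sum_distrib_left mult.commute)
    have "(\<Sum>k<l. expectation (\<lambda>\<omega>. (c k l * y k \<omega>) ^ 4)) \<le> (\<Sum>k<l. c k l ^ 4 * \<kappa>)"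
      by (intro sum_mono) (auto simp: power_mult_distrib intro!: mult_left_mono \<kappa>)
    also have "\<dots> = \<kappa> * (\<Sum>k<l. c k l ^ 4)"
      by (simp add: sum_distrib_left mult.commute)
    also have "\<dots> \<le> \<kappa> * (\<Sum>k<l. c k l ^ 2)\<^sup>2"
      using le \<kappa>0 by (intro mult_left_mono)
    finally have s4: "(\<Sum>k<l. expectation (\<lambda>\<omega>. (c k l * y k \<omega>) ^ 4)) \<le> \<kappa> * (\<Sum>k<l. c k l ^ 2)\<^sup>2" .
    have "expectation (\<lambda>\<omega>. ?D l \<omega> ^ 4) \<le> A * (\<Sum>k<l. c k l ^ 2)\<^sup>2"
      using ros(3) s2 s4 by (simp add: A_def power_mult_distrib algebra_simps)
    also have "\<dots> \<le> A * e\<^sup>2"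
      using e A0 by (intro mult_left_mono)
    finally show ?thesis
      using ros(1) by blast
  qed
  have "m \<le> n \<Longrightarrow> integrable M (\<lambda>\<omega>. (\<Sum>l<m. y l \<omega> * ?D l \<omega>) ^ 4)
    \<and> expectation (\<lambda>\<omega>. (\<Sum>l<m. y l \<omega> * ?D l \<omega>) ^ 4) \<le> C * e\<^sup>2 * (real m)\<^sup>2" for m
  proof (induction m)
    case 0
    then show ?case by simp
  next
    case (Suc m)
    let ?S = "\<lambda>\<omega>. \<Sum>l<m. y l \<omega> * ?D l \<omega>"
    have S4: "integrable M (\<lambda>\<omega>. ?S \<omega> ^ 4)"
      and IH: "expectation (\<lambda>\<omega>. ?S \<omega> ^ 4) \<le> C * e\<^sup>2 * (real m)\<^sup>2"
      using Suc by auto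
    have D4: "integrable M (\<lambda>\<omega>. ?D m \<omega> ^ 4)" and De: "expectation (\<lambda>\<omega>. ?D m \<omega> ^ 4) \<le> A * e\<^sup>2"
      using D[of m] Suc.prems by auto
    have ind: "indep_var borel (\<lambda>\<omega>. y m \<omega> ^ i) borel (\<lambda>\<omega>. ?D m \<omega> ^ j * ?S \<omega> ^ l)" for i j l
      by (rule indep_var_next_past[OF indep, of "\<lambda>x. x ^ i"
            "\<lambda>u. (\<Sum>k<m. c k m * u k) ^ j * (\<Sum>l<m. u l * (\<Sum>k<l. c k l * u k)) ^ l" m]) auto
    note step = fourth_moment_step[OF ind y4 D4 S4 mean]
    have DS: "expectation (\<lambda>\<omega>. ?D m \<omega> ^ 2 * ?S \<omega> ^ 2) \<le> (t * A + C / t) * e\<^sup>2 * real m / 2"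
    proof (cases "m = 0")
      case False
      (* The weight balances the two moments, of order e^2 and m^2 e^2, in 2 D^2 S^2 <= \<tau> D^4 + S^4 / \<tau>.
         The factor t makes the multiple of C that comes back small enough for the induction. *)
      define \<tau> where "\<tau> = t * real m"
      have \<tau>: "0 < \<tau>" using False t1 by (simp add: \<tau>_def)
      have "expectation (\<lambda>\<omega>. ?D m \<omega> ^ 2 * ?S \<omega> ^ 2)
          \<le> expectation (\<lambda>\<omega>. \<tau> / 2 * ?D m \<omega> ^ 4 + 1 / (2 * \<tau>) * ?S \<omega> ^ 4)"
      proof (intro integral_mono Bochner_Integration.integrable_add integrable_mult_right D4 S4
          integrable_monomial_of_fourth)
        fix \<omega>
        have "0 \<le> (\<tau> * ?D m \<omega> ^ 2 - ?S \<omega> ^ 2)\<^sup>2 / (2 * \<tau>)"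
          using \<tau> by simp
        also have "\<dots> = \<tau> / 2 * ?D m \<omega> ^ 4 + 1 / (2 * \<tau>) * ?S \<omega> ^ 4 - ?D m \<omega> ^ 2 * ?S \<omega> ^ 2"
          using \<tau> by (simp add: field_simps power2_diff) (simp add: power_numeral_reduce algebra_simps)
        finally show "?D m \<omega> ^ 2 * ?S \<omega> ^ 2 \<le> \<tau> / 2 * ?D m \<omega> ^ 4 + 1 / (2 * \<tau>) * ?S \<omega> ^ 4"
          by simp
      qed auto
      also have "\<dots> = \<tau> / 2 * expectation (\<lambda>\<omega>. ?D m \<omega> ^ 4) + 1 / (2 * \<tau>) * expectation (\<lambda>\<omega>. ?S \<omega> ^ 4)"
        using D4 S4 by simp
      also have "\<dots> \<le> \<tau> / 2 * (A * e\<^sup>2) + 1 / (2 * \<tau>) * (C * e\<^sup>2 * (real m)\<^sup>2)"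
        using \<tau> De IH by (intro add_mono mult_left_mono) auto
      also have "\<dots> = (t * A + C / t) * e\<^sup>2 * real m / 2"
        using False t1 by (simp add: \<tau>_def field_simps power2_eq_square)
      finally show ?thesis .
    qed simp
    have "expectation (\<lambda>\<omega>. (\<Sum>l<Suc m. y l \<omega> * ?D l \<omega>) ^ 4) \<le> expectation (\<lambda>\<omega>. ?S \<omega> ^ 4)
        + 8 * expectation (\<lambda>\<omega>. y m \<omega> ^ 2) * expectation (\<lambda>\<omega>. ?D m \<omega> ^ 2 * ?S \<omega> ^ 2)
        + 3 * expectation (\<lambda>\<omega>. y m \<omega> ^ 4) * expectation (\<lambda>\<omega>. ?D m \<omega> ^ 4)"
      using step(2) by simp
    also have "\<dots> \<le> C * e\<^sup>2 * (real m)\<^sup>2 + 8 * v * ((t * A + C / t) * e\<^sup>2 * real m / 2) + 3 * \<kappa> * (A * e\<^sup>2)"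
      using v0 \<kappa>0 by (intro add_mono mult_mono IH DS De v \<kappa> mult_left_mono) auto
    also have "\<dots> = C * e\<^sup>2 * (real m)\<^sup>2 + (4 * v * t * A + (4 * v / t) * C) * (e\<^sup>2 * real m) + 3 * \<kappa> * A * e\<^sup>2"
      by (simp add: algebra_simps)
    also have "\<dots> \<le> C * e\<^sup>2 * (real m)\<^sup>2 + (C + 1 * C) * (e\<^sup>2 * real m) + C * e\<^sup>2"
      using t1 C0 A0 v0 \<kappa>0
      by (intro add_mono mult_right_mono order_refl) (auto simp: C_eq)
    also have "\<dots> = C * e\<^sup>2 * (real (Suc m))\<^sup>2"
      by (simp add: power2_eq_square algebra_simps)
    finally show ?case
      using step(1) by simp
  qed
  from this[of n] show "integrable M (\<lambda>\<omega>. (\<Sum>l<n. y l \<omega> * ?D l \<omega>) ^ 4)"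
    and "expectation (\<lambda>\<omega>. (\<Sum>l<n. y l \<omega> * ?D l \<omega>) ^ 4) \<le> C * e\<^sup>2 * (real n)\<^sup>2"
    by auto
qed

section \<open>From moment bounds to almost sure convergence\<close>

text \<open>
  The fourth moments of $Z_n / n$ are $O(n^{-2})$, so their sum over \<open>n\<close> has finite expectation and is
  almost surely finite; its terms then tend to 0.
\<close>
lemma AE_tendsto_0_of_fourth_moments:
  fixes Z :: "nat \<Rightarrow> 'a \<Rightarrow> real"
  assumes [measurable]: "\<And>n. Z n \<in> borel_measurable M"
    and bound: "\<And>n. (\<integral>\<^sup>+\<omega>. ennreal (Z n \<omega> ^ 4) \<partial>M) \<le> ennreal (C * (real n)\<^sup>2)"
  shows "AE \<omega> in M. (\<lambda>n. Z n \<omega> / real n) \<longlonglongrightarrow> 0"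
proof -
  define C' where "C' = max C 0"
  have nth: "(\<integral>\<^sup>+\<omega>. ennreal ((Z n \<omega> / real n) ^ 4) \<partial>M) \<le> ennreal (C' / (real n)\<^sup>2)" for n
  proof (cases "n = 0")
    case False
    have "(\<integral>\<^sup>+\<omega>. ennreal ((Z n \<omega> / real n) ^ 4) \<partial>M)
        = (\<integral>\<^sup>+\<omega>. ennreal (1 / real n ^ 4) * ennreal (Z n \<omega> ^ 4) \<partial>M)"
      by (simp add: power_divide ennreal_mult[symmetric])
    also have "\<dots> = ennreal (1 / real n ^ 4) * (\<integral>\<^sup>+\<omega>. ennreal (Z n \<omega> ^ 4) \<partial>M)"
      by (rule nn_integral_cmult) measurable
    also have "\<dots> \<le> ennreal (1 / real n ^ 4) * ennreal (C' * (real n)\<^sup>2)"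
      by (intro mult_left_mono order_trans[OF bound] ennreal_leI mult_right_mono) (auto simp: C'_def)
    also have "\<dots> = ennreal (C' / (real n)\<^sup>2)"
      using False by (simp add: C'_def ennreal_mult[symmetric] field_simps power_numeral_reduce)
    finally show ?thesis .
  qed simp
  have summ: "summable (\<lambda>n. C' / (real n)\<^sup>2)"
    using inverse_power_summable[of 2, where 'a = real]
    by (auto simp: divide_inverse intro!: summable_mult)
  have "(\<integral>\<^sup>+\<omega>. (\<Sum>n. ennreal ((Z n \<omega> / real n) ^ 4)) \<partial>M)
      = (\<Sum>n. \<integral>\<^sup>+\<omega>. ennreal ((Z n \<omega> / real n) ^ 4) \<partial>M)"
    by (rule nn_integral_suminf) measurable
  also have "\<dots> \<le> (\<Sum>n. ennreal (C' / (real n)\<^sup>2))"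
    by (intro suminf_le nth) auto
  also have "\<dots> = ennreal (\<Sum>n. C' / (real n)\<^sup>2)"
    by (intro suminf_ennreal2 summ) (simp add: C'_def)
  also have "\<dots> < \<infinity>"
    by simp
  finally have "AE \<omega> in M. (\<Sum>n. ennreal ((Z n \<omega> / real n) ^ 4)) \<noteq> \<infinity>"
    by (intro nn_integral_noteq_infinite) auto
  then show ?thesis
  proof (eventually_elim)
    fix \<omega>
    assume "(\<Sum>n. ennreal ((Z n \<omega> / real n) ^ 4)) \<noteq> \<infinity>"
    then have "summable (\<lambda>n. (Z n \<omega> / real n) ^ 4)"
      by (intro summable_suminf_not_top) auto
    then have "(\<lambda>n. (Z n \<omega> / real n) ^ 4) \<longlonglongrightarrow> 0"
      by (rule summable_LIMSEQ_zero)
    then have "(\<lambda>n. root 4 ((Z n \<omega> / real n) ^ 4)) \<longlonglongrightarrow> root 4 0"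
      by (rule tendsto_real_root)
    moreover have "root 4 (x ^ 4) = \<bar>x\<bar>" for x :: real
      using real_root_power_cancel[of 4 "\<bar>x\<bar>"] by (simp add: power_even_abs)
    ultimately show "(\<lambda>n. Z n \<omega> / real n) \<longlonglongrightarrow> 0"
      by (subst tendsto_rabs_zero_iff[symmetric]) simp
  qed
qed

text \<open>
  Under a product law, \<open>H\<close> can be frozen at each of its values: a bound for \<open>f (X, H \<omega>')\<close> that is
  uniform in \<open>\<omega>'\<close> is a bound for \<open>f (X, H)\<close>.
\<close>
lemma nn_integral_bound_of_indep:
  fixes f :: "'b \<times> 'c \<Rightarrow> ennreal"
  assumes [measurable]: "X \<in> measurable M N1" "H \<in> measurable M N2"
    and prod: "distr M (N1 \<Otimes>\<^sub>M N2) (\<lambda>\<omega>. (X \<omega>, H \<omega>)) = distr M N1 X \<Otimes>\<^sub>M distr M N2 H"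
    and [measurable]: "f \<in> borel_measurable (N1 \<Otimes>\<^sub>M N2)"
    and bound: "\<And>\<omega>'. \<omega>' \<in> space M \<Longrightarrow> (\<integral>\<^sup>+\<omega>. f (X \<omega>, H \<omega>') \<partial>M) \<le> c"
  shows "(\<integral>\<^sup>+\<omega>. f (X \<omega>, H \<omega>) \<partial>M) \<le> c"
proof -
  interpret DX: prob_space "distr M N1 X" by (rule prob_space_distr) measurable
  interpret DH: prob_space "distr M N2 H" by (rule prob_space_distr) measurable
  interpret P: pair_sigma_finite "distr M N1 X" "distr M N2 H" ..
  have "(\<integral>\<^sup>+\<omega>. f (X \<omega>, H \<omega>) \<partial>M) = (\<integral>\<^sup>+z. f z \<partial>(distr M (N1 \<Otimes>\<^sub>M N2) (\<lambda>\<omega>. (X \<omega>, H \<omega>))))"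
    by (subst nn_integral_distr) auto
  also have "\<dots> = (\<integral>\<^sup>+h. \<integral>\<^sup>+x. f (x, h) \<partial>distr M N1 X \<partial>distr M N2 H)"
    unfolding prod by (rule P.nn_integral_snd[symmetric]) simp
  also have "\<dots> = (\<integral>\<^sup>+\<omega>'. (\<integral>\<^sup>+x. f (x, H \<omega>') \<partial>distr M N1 X) \<partial>M)"
    by (rule nn_integral_distr) (auto intro!: DX.borel_measurable_nn_integral)
  also have "\<dots> \<le> (\<integral>\<^sup>+\<omega>'. c \<partial>M)"
  proof (rule nn_integral_mono)
    fix \<omega>' assume "\<omega>' \<in> space M"
    then have "H \<omega>' \<in> space N2" by (rule measurable_space[rotated]) measurable
    then show "(\<integral>\<^sup>+x. f (x, H \<omega>') \<partial>distr M N1 X) \<le> c"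
      using bound[OF \<open>\<omega>' \<in> space M\<close>] by (subst nn_integral_distr) auto
  qed
  also have "\<dots> = c"
    by (simp add: emeasure_space_1)
  finally show ?thesis .
qed

end

section \<open>Strong laws with independent random weights\<close>

lemma sum_inverse_sqrt_le: "(\<Sum>k<n. 1 / sqrt (real (Suc k))) \<le> 2 * sqrt (real n)"
proof (induction n)
  case (Suc n)
  have "1 / sqrt (real (Suc n)) \<le> 2 * (sqrt (real (Suc n)) - sqrt (real n))"
  proof -
    have "1 = (sqrt (real (Suc n)) - sqrt (real n)) * (sqrt (real (Suc n)) + sqrt (real n))"
      by (simp add: algebra_simps)
    also have "\<dots> \<le> (sqrt (real (Suc n)) - sqrt (real n)) * (2 * sqrt (real (Suc n)))"
      by (intro mult_left_mono) auto
    finally show ?thesis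
      by (simp add: field_simps)
  qed
  with Suc show ?case by simp
qed simp

lemma sum_tail_indicators_le:
  fixes x :: real
  assumes "0 \<le> x"
  shows "(\<Sum>k<n. indicator {real (Suc k)<..} x) \<le> x"
proof -
  have "(\<Sum>k<n. indicator {real (Suc k)<..} x) = real (card {k. k < n \<and> real (Suc k) < x})"
    by (simp add: indicator_def sum.If_cases Int_def)
  also have "card {k. k < n \<and> real (Suc k) < x} \<le> card {..<nat \<lfloor>x\<rfloor>}"
  proof (intro card_mono subsetI)
    fix k assume "k \<in> {k. k < n \<and> real (Suc k) < x}"
    then have "int (Suc k) \<le> \<lfloor>x\<rfloor>"
      by (simp add: le_floor_iff)
    then show "k \<in> {..<nat \<lfloor>x\<rfloor>}"
      by simp
  qed simp
  also have "real (card {..<nat \<lfloor>x\<rfloor>}) \<le> x"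
    using assms by simp
  finally show ?thesis by simp
qed

context prob_space
begin

text \<open>
  An integrable variable exceeds the level \<open>k + 1\<close> for at most \<open>W\<close> values of \<open>k\<close>, so the tail
  probabilities sum to at most the expectation of \<open>W\<close>.
\<close>
lemma summable_tail_probabilities:
  fixes W :: "'a \<Rightarrow> real"
  assumes int: "integrable M W" and nonneg: "\<And>\<omega>. 0 \<le> W \<omega>"
  shows "summable (\<lambda>k. prob {\<omega> \<in> space M. real (Suc k) < W \<omega>})"
proof (rule summableI_nonneg_bounded)
  fix n
  have [measurable]: "W \<in> borel_measurable M"
    using int by auto
  have ind: "indicator {\<omega> \<in> space M. real (Suc k) < W \<omega>} \<omega> = (indicator {real (Suc k)<..} (W \<omega>) :: real)"
    if "\<omega> \<in> space M" for k \<omega>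
    using that by (simp add: indicator_def)
  have "(\<Sum>k<n. prob {\<omega> \<in> space M. real (Suc k) < W \<omega>})
      = (\<Sum>k<n. expectation (indicator {\<omega> \<in> space M. real (Suc k) < W \<omega>}))"
    by simp
  also have "\<dots> = expectation (\<lambda>\<omega>. \<Sum>k<n. indicator {\<omega> \<in> space M. real (Suc k) < W \<omega>} \<omega>)"
    by (rule Bochner_Integration.integral_sum[symmetric]) (auto simp: emeasure_eq_measure)
  also have "\<dots> = expectation (\<lambda>\<omega>. \<Sum>k<n. indicator {real (Suc k)<..} (W \<omega>))"
    by (intro Bochner_Integration.integral_cong refl sum.cong ind)
  also have "\<dots> \<le> expectation W"
  proof (rule integral_mono)
    show "integrable M (\<lambda>\<omega>. \<Sum>k<n. indicator {real (Suc k)<..} (W \<omega>) :: real)"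
      by (intro Bochner_Integration.integrable_sum integrable_const_bound[where B = 1])
        (auto simp: indicator_def)
  qed (use sum_tail_indicators_le[OF nonneg] int in auto)
  finally show "(\<Sum>k<n. prob {\<omega> \<in> space M. real (Suc k) < W \<omega>}) \<le> expectation W" .
qed auto

lemma expectation_ident_distr:
  fixes f :: "'b \<Rightarrow> real"
  assumes "X \<in> measurable M N" "Y \<in> measurable M N" "distr M N X = distr M N Y" "f \<in> borel_measurable N"
  shows "expectation (\<lambda>\<omega>. f (X \<omega>)) = expectation (\<lambda>\<omega>. f (Y \<omega>))"
    and "integrable M (\<lambda>\<omega>. f (X \<omega>)) \<longleftrightarrow> integrable M (\<lambda>\<omega>. f (Y \<omega>))"
  using integral_distr[OF assms(1,4)] integral_distr[OF assms(2,4)]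
    integrable_distr_eq[OF assms(1,4)] integrable_distr_eq[OF assms(2,4)] assms(3)
  by auto

end

text \<open>
  The variables of the limit theorems are functions of \<open>X\<close> and their weights are functions of \<open>H\<close>.
  Independence is expressed by the joint law, because \<open>X\<close> and \<open>H\<close> take values in different types.
\<close>
locale independent_weights = prob_space M
  for M :: "'a measure" +
  fixes X :: "'a \<Rightarrow> 'b" and H :: "'a \<Rightarrow> 'c" and N1 :: "'b measure" and N2 :: "'c measure"
  assumes X_measurable [measurable]: "X \<in> measurable M N1"
    and H_measurable [measurable]: "H \<in> measurable M N2"
    and joint_law: "distr M (N1 \<Otimes>\<^sub>M N2) (\<lambda>\<omega>. (X \<omega>, H \<omega>)) = distr M N1 X \<Otimes>\<^sub>M distr M N2 H"
begin

text \<open>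
  The weights may change completely with \<open>n\<close>, so the law for averages of the variables does not
  imply this one by summation by parts; bounds on fourth moments treat every \<open>n\<close>
  separately. The truncation level $\sqrt{k+1}$ is high enough
  for \<open>summable_tail_probabilities\<close>, applied to the square of the variable, and low enough for
  $E x_k^4 = O(k)$, which keeps the sum of the first \<open>n\<close> of these moments $O(n^2)$.
\<close>
lemma weighted_strong_law:
  fixes w :: "nat \<Rightarrow> 'b \<Rightarrow> real" and a :: "nat \<Rightarrow> nat \<Rightarrow> 'c \<Rightarrow> real"
  assumes w_meas [measurable]: "\<And>k. w k \<in> borel_measurable N1"
    and a_meas [measurable]: "\<And>n k. k < n \<Longrightarrow> a n k \<in> borel_measurable N2"
    and indep: "indep_vars (\<lambda>_. borel) (\<lambda>k \<omega>. w k (X \<omega>)) UNIV"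
    and ident: "\<And>k. distr M borel (\<lambda>\<omega>. w k (X \<omega>)) = distr M borel (\<lambda>\<omega>. w 0 (X \<omega>))"
    and w2: "integrable M (\<lambda>\<omega>. w 0 (X \<omega>) ^ 2)"
    and a: "\<And>n k \<omega>. k < n \<Longrightarrow> \<omega> \<in> space M \<Longrightarrow> \<bar>a n k (H \<omega>)\<bar> \<le> K"
  defines "v \<equiv> expectation (\<lambda>\<omega>. w 0 (X \<omega>))"
  shows "AE \<omega> in M. (\<lambda>n. (\<Sum>k<n. a n k (H \<omega>) * (w k (X \<omega>) - v)) / real n) \<longlonglongrightarrow> 0"
proof -
  define \<kappa> where "\<kappa> = expectation (\<lambda>\<omega>. w 0 (X \<omega>) ^ 2)"
  define tr where "tr k x = (if x ^ 2 \<le> real (Suc k) then x else 0)" for k and x :: real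
  have tr_meas [measurable]: "tr k \<in> borel_measurable borel" for k
    unfolding tr_def by measurable
  define m where "m k = expectation (\<lambda>\<omega>. tr k (w k (X \<omega>)))" for k
  define x where "x k \<omega> = tr k (w k (X \<omega>)) - m k" for k \<omega>
  have law: "expectation (\<lambda>\<omega>. f (w k (X \<omega>))) = expectation (\<lambda>\<omega>. f (w 0 (X \<omega>)))"
    and law_int: "integrable M (\<lambda>\<omega>. f (w k (X \<omega>))) \<longleftrightarrow> integrable M (\<lambda>\<omega>. f (w 0 (X \<omega>)))"
    if "f \<in> borel_measurable borel" for f :: "real \<Rightarrow> real" and k
    using expectation_ident_distr[OF _ _ ident that] by auto
  have \<kappa>0: "0 \<le> \<kappa>"
    unfolding \<kappa>_def by simp
  obtain \<omega>0 where "\<omega>0 \<in> space M"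
    using not_empty by auto
  then have K0: "0 \<le> K"
    using a[of 0 1 \<omega>0] by simp
  have w2': "integrable M (\<lambda>\<omega>. w k (X \<omega>) ^ 2)" and w2_eq: "expectation (\<lambda>\<omega>. w k (X \<omega>) ^ 2) = \<kappa>" for k
    using law_int[of "\<lambda>x. x ^ 2" k] law[of "\<lambda>x. x ^ 2" k] w2 by (auto simp: \<kappa>_def)
  have w1: "integrable M (\<lambda>\<omega>. w k (X \<omega>))" for k
    by (rule square_integrable_imp_integrable[OF _ w2']) measurable
  have tr_abs: "\<bar>tr k y\<bar> \<le> sqrt (real (Suc k))" for k y
    unfolding tr_def using real_sqrt_le_mono[of "y ^ 2"] by auto
  have tr_int: "integrable M (\<lambda>\<omega>. tr k (w k (X \<omega>)))" for k
    using tr_abs by (intro integrable_const_bound[where B = "sqrt (real (Suc k))"]) auto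
  have m_abs: "\<bar>m k\<bar> \<le> sqrt (real (Suc k))" for k
  proof -
    have "\<bar>m k\<bar> \<le> expectation (\<lambda>\<omega>. \<bar>tr k (w k (X \<omega>))\<bar>)"
      unfolding m_def by (rule integral_abs_bound)
    also have "\<dots> \<le> expectation (\<lambda>\<omega>. sqrt (real (Suc k)))"
      using tr_abs tr_int by (intro integral_mono) auto
    finally show ?thesis by (simp add: prob_space)
  qed
  have x_abs: "\<bar>x k \<omega>\<bar> \<le> 2 * sqrt (real (Suc k))" for k \<omega>
    using tr_abs[of k "w k (X \<omega>)"] m_abs[of k] unfolding x_def by linarith
  have x_meas [measurable]: "x k \<in> borel_measurable M" for k
    unfolding x_def by measurable
  have x_mean: "expectation (x k) = 0" for k
    unfolding x_def using tr_int[of k] by (simp add: m_def prob_space)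
  have x_indep: "indep_vars (\<lambda>_. borel) x UNIV"
    unfolding x_def by (rule indep_vars_compose2[OF indep, of "\<lambda>k y. tr k y - m k"]) measurable
  have x_pow_int: "integrable M (\<lambda>\<omega>. x k \<omega> ^ i)" for k i
    using power_mono[OF x_abs abs_ge_zero, of k _ i]
    by (intro integrable_const_bound[where B = "(2 * sqrt (real (Suc k))) ^ i"]) (auto simp: power_abs)
  have x2: "expectation (\<lambda>\<omega>. x k \<omega> ^ 2) \<le> \<kappa>" for k
  proof -
    have sq_int: "integrable M (\<lambda>\<omega>. tr k (w k (X \<omega>)) ^ 2)"
      by (rule Bochner_Integration.integrable_bound[OF w2'[of k]]) (auto simp: tr_def)
    have "expectation (\<lambda>\<omega>. x k \<omega> ^ 2) = expectation (\<lambda>\<omega>. tr k (w k (X \<omega>)) ^ 2) - (m k)\<^sup>2"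
      using variance_eq[OF tr_int sq_int] by (simp add: x_def m_def)
    also have "\<dots> \<le> expectation (\<lambda>\<omega>. tr k (w k (X \<omega>)) ^ 2)"
      by simp
    also have "\<dots> \<le> expectation (\<lambda>\<omega>. w k (X \<omega>) ^ 2)"
      using sq_int w2' by (intro integral_mono) (auto simp: tr_def)
    finally show ?thesis by (simp add: w2_eq)
  qed
  have x4: "expectation (\<lambda>\<omega>. x k \<omega> ^ 4) \<le> 4 * real (Suc k) * \<kappa>" for k
  proof -
    have "x k \<omega> ^ 4 \<le> 4 * real (Suc k) * x k \<omega> ^ 2" for \<omega>
    proof -
      have "x k \<omega> ^ 2 \<le> (2 * sqrt (real (Suc k))) ^ 2"
        using power_mono[OF x_abs, of k \<omega> 2] by simp
      then have "x k \<omega> ^ 2 * x k \<omega> ^ 2 \<le> 4 * real (Suc k) * x k \<omega> ^ 2"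
        by (intro mult_right_mono) (auto simp: power_mult_distrib)
      then show ?thesis by (simp add: power_add[symmetric])
    qed
    then have "expectation (\<lambda>\<omega>. x k \<omega> ^ 4) \<le> expectation (\<lambda>\<omega>. 4 * real (Suc k) * x k \<omega> ^ 2)"
      by (intro integral_mono x_pow_int integrable_mult_right)
    also have "\<dots> \<le> 4 * real (Suc k) * \<kappa>"
      using x2[of k] by (simp add: mult_left_mono)
    finally show ?thesis .
  qed
  define C where "C = 4 * \<kappa>\<^sup>2 * K ^ 4 + 12 * \<kappa> * K ^ 4"
  have "AE \<omega> in M. (\<lambda>n. (\<Sum>k<n. a n k (H \<omega>) * x k \<omega>) / real n) \<longlonglongrightarrow> 0"
  proof (rule AE_tendsto_0_of_fourth_moments)
    fix n
    have [measurable]: "(\<lambda>z. a n k (snd z)) \<in> borel_measurable (N1 \<Otimes>\<^sub>M N2)" if "k < n" for k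
      using that by measurable
    have [measurable]: "(\<lambda>\<omega>. a n k (H \<omega>)) \<in> borel_measurable M" if "k < n" for k
      using that by measurable
    show "(\<lambda>\<omega>. \<Sum>k<n. a n k (H \<omega>) * x k \<omega>) \<in> borel_measurable M"
      by measurable
    let ?f = "\<lambda>z. ennreal ((\<Sum>k<n. a n k (snd z) * (tr k (w k (fst z)) - m k)) ^ 4)"
    have "(\<integral>\<^sup>+\<omega>. ?f (X \<omega>, H \<omega>) \<partial>M) \<le> ennreal (C * (real n)\<^sup>2)"
    proof (rule nn_integral_bound_of_indep[OF X_measurable H_measurable joint_law])
      show "?f \<in> borel_measurable (N1 \<Otimes>\<^sub>M N2)"
        by measurable
      fix \<omega>' assume \<omega>': "\<omega>' \<in> space M"
      define b where "b k = (if k < n then a n k (H \<omega>') else 0)" for k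
      have b: "\<bar>b k\<bar> \<le> K" for k
        using a[OF _ \<omega>'] K0 by (auto simp: b_def)
      have ind: "indep_vars (\<lambda>_. borel) (\<lambda>k \<omega>. b k * x k \<omega>) UNIV"
        by (rule indep_vars_compose2[OF x_indep]) auto
      have int4: "integrable M (\<lambda>\<omega>. (b k * x k \<omega>) ^ 4)" for k
        using x_pow_int[of k 4] by (simp add: power_mult_distrib)
      have mean: "expectation (\<lambda>\<omega>. b k * x k \<omega>) = 0" for k
        using x_mean[of k] by simp
      note ros = sum_of_independent_moments[OF ind int4 mean, of n]
      have b2: "b k ^ 2 \<le> K ^ 2" and b4: "b k ^ 4 \<le> K ^ 4" for k
        using power_mono[OF b, of k 2] power_mono[OF b, of k 4] by (simp_all add: power_even_abs)
      have "(\<Sum>k<n. expectation (\<lambda>\<omega>. (b k * x k \<omega>) ^ 2)) \<le> (\<Sum>k<n. K ^ 2 * \<kappa>)"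
        by (intro sum_mono) (auto simp: power_mult_distrib intro!: mult_mono b2 x2)
      then have s2: "(\<Sum>k<n. expectation (\<lambda>\<omega>. (b k * x k \<omega>) ^ 2))\<^sup>2 \<le> (real n * (K ^ 2 * \<kappa>))\<^sup>2"
        by (intro power_mono sum_nonneg) auto
      have "(\<Sum>k<n. expectation (\<lambda>\<omega>. (b k * x k \<omega>) ^ 4)) \<le> (\<Sum>k<n. K ^ 4 * (4 * real n * \<kappa>))"
      proof (intro sum_mono)
        fix k assume "k \<in> {..<n}"
        then have "expectation (\<lambda>\<omega>. x k \<omega> ^ 4) \<le> 4 * real n * \<kappa>"
          using \<kappa>0 by (intro order_trans[OF x4] mult_right_mono) auto
        then show "expectation (\<lambda>\<omega>. (b k * x k \<omega>) ^ 4) \<le> K ^ 4 * (4 * real n * \<kappa>)"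
          using K0 by (auto simp: power_mult_distrib intro!: mult_mono b4)
      qed
      then have "expectation (\<lambda>\<omega>. (\<Sum>k<n. b k * x k \<omega>) ^ 4)
          \<le> 4 * (real n * (K ^ 2 * \<kappa>))\<^sup>2 + 3 * (real n * (K ^ 4 * (4 * real n * \<kappa>)))"
        using ros(3) s2 by simp
      also have "\<dots> = C * (real n)\<^sup>2"
        by (simp add: C_def algebra_simps power_numeral_reduce)
      finally have "ennreal (expectation (\<lambda>\<omega>. (\<Sum>k<n. b k * x k \<omega>) ^ 4)) \<le> ennreal (C * (real n)\<^sup>2)"
        by (rule ennreal_leI)
      moreover have "(\<integral>\<^sup>+\<omega>. ennreal ((\<Sum>k<n. b k * x k \<omega>) ^ 4) \<partial>M)
          = ennreal (expectation (\<lambda>\<omega>. (\<Sum>k<n. b k * x k \<omega>) ^ 4))"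
        using ros(1) by (intro nn_integral_eq_integral) auto
      ultimately show "(\<integral>\<^sup>+\<omega>. ?f (X \<omega>, H \<omega>') \<partial>M) \<le> ennreal (C * (real n)\<^sup>2)"
        by (simp add: b_def x_def)
    qed
    then show "(\<integral>\<^sup>+\<omega>. ennreal ((\<Sum>k<n. a n k (H \<omega>) * x k \<omega>) ^ 4) \<partial>M) \<le> ennreal (C * (real n)\<^sup>2)"
      by (simp add: x_def)
  qed
  moreover have "AE \<omega> in M. eventually (\<lambda>k. tr k (w k (X \<omega>)) = w k (X \<omega>)) sequentially"
  proof -
    have "AE \<omega> in M. eventually (\<lambda>k. \<omega> \<in> space M - {\<omega> \<in> space M. real (Suc k) < w k (X \<omega>) ^ 2}) sequentially"
    proof (rule borel_cantelli_AE1)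
      have "prob {\<omega> \<in> space M. real (Suc k) < w k (X \<omega>) ^ 2}
          = prob {\<omega> \<in> space M. real (Suc k) < w 0 (X \<omega>) ^ 2}" for k
      proof -
        have "prob {\<omega> \<in> space M. real (Suc k) < w j (X \<omega>) ^ 2}
          = measure (distr M borel (\<lambda>\<omega>. w j (X \<omega>))) {y. real (Suc k) < y ^ 2}" for j
          by (subst measure_distr) (auto intro!: arg_cong[where f = prob])
        then show ?thesis using ident[of k] by simp
      qed
      then show "summable (\<lambda>k. prob {\<omega> \<in> space M. real (Suc k) < w k (X \<omega>) ^ 2})"
        using summable_tail_probabilities[OF w2] by simp
    qed (auto simp: emeasure_eq_measure)
    then show ?thesis
      by eventually_elim (auto elim!: eventually_mono simp: tr_def)
  qed
  moreover have "AE \<omega> in M. \<omega> \<in> space M"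
    by simp
  ultimately show ?thesis
  proof eventually_elim
    case (elim \<omega>)
    note av = elim(1) and ev = elim(2) and \<omega> = elim(3)
    (* The remainder is the truncation error, with finitely many non-zero terms, plus the bias of the
       truncated means. *)
    from ev obtain N where N: "\<And>k. N \<le> k \<Longrightarrow> tr k (w k (X \<omega>)) = w k (X \<omega>)"
      unfolding eventually_sequentially by auto
    define E where "E = K * (\<Sum>k<N. \<bar>w k (X \<omega>) - tr k (w k (X \<omega>))\<bar>)"
    have trunc: "\<bar>\<Sum>k<n. a n k (H \<omega>) * (w k (X \<omega>) - tr k (w k (X \<omega>)))\<bar> \<le> E" for n
    proof -
      have "\<bar>\<Sum>k<n. a n k (H \<omega>) * (w k (X \<omega>) - tr k (w k (X \<omega>)))\<bar>
          \<le> (\<Sum>k<n. K * \<bar>w k (X \<omega>) - tr k (w k (X \<omega>))\<bar>)"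
        by (intro order_trans[OF sum_abs] sum_mono) (auto simp: abs_mult intro!: mult_right_mono a \<omega>)
      also have "\<dots> = (\<Sum>k\<in>{..<n} \<inter> {..<N}. K * \<bar>w k (X \<omega>) - tr k (w k (X \<omega>))\<bar>)"
        by (intro sum.mono_neutral_right) (auto, metis N not_le)
      also have "\<dots> \<le> (\<Sum>k<N. K * \<bar>w k (X \<omega>) - tr k (w k (X \<omega>))\<bar>)"
        using K0 by (intro sum_mono2) auto
      finally show ?thesis by (simp add: E_def sum_distrib_left)
    qed
    have bias: "\<bar>m k - v\<bar> \<le> \<kappa> / sqrt (real (Suc k))" for k
    proof -
      have "m k - v = expectation (\<lambda>\<omega>. tr k (w k (X \<omega>)) - w k (X \<omega>))"
        using tr_int[of k] w1[of k] law[of "\<lambda>y. y" k] by (simp add: m_def v_def)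
      also have "\<bar>\<dots>\<bar> \<le> expectation (\<lambda>\<omega>. \<bar>tr k (w k (X \<omega>)) - w k (X \<omega>)\<bar>)"
        by (rule integral_abs_bound)
      also have "\<dots> \<le> expectation (\<lambda>\<omega>. w k (X \<omega>) ^ 2 / sqrt (real (Suc k)))"
      proof (intro integral_mono)
        fix \<omega>
        let ?y = "w k (X \<omega>)"
        show "\<bar>tr k ?y - ?y\<bar> \<le> ?y ^ 2 / sqrt (real (Suc k))"
        proof (cases "?y ^ 2 \<le> real (Suc k)")
          case False
          then have "sqrt (real (Suc k)) \<le> \<bar>?y\<bar>"
            using real_sqrt_le_mono[of "real (Suc k)" "?y ^ 2"] by simp
          then have "\<bar>?y\<bar> * sqrt (real (Suc k)) \<le> \<bar>?y\<bar> * \<bar>?y\<bar>"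
            by (intro mult_left_mono) auto
          then show ?thesis
            using False by (simp add: tr_def field_simps power2_eq_square)
        qed (simp add: tr_def)
      qed (use tr_int w1 w2' in auto)
      finally show ?thesis by (simp add: w2_eq)
    qed
    have bias_sum: "\<bar>\<Sum>k<n. a n k (H \<omega>) * (m k - v)\<bar> \<le> K * \<kappa> * 2 * sqrt (real n)" for n
    proof -
      have "\<bar>\<Sum>k<n. a n k (H \<omega>) * (m k - v)\<bar> \<le> (\<Sum>k<n. K * (\<kappa> / sqrt (real (Suc k))))"
        unfolding abs_mult using K0
        by (intro order_trans[OF sum_abs] sum_mono) (simp only: abs_mult, intro mult_mono a \<omega> bias, auto)
      also have "\<dots> = K * \<kappa> * (\<Sum>k<n. 1 / sqrt (real (Suc k)))"
        by (simp add: sum_distrib_left)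
      also have "\<dots> \<le> K * \<kappa> * (2 * sqrt (real n))"
        using K0 \<kappa>0 by (intro mult_left_mono sum_inverse_sqrt_le) auto
      finally show ?thesis by simp
    qed
    have "(\<lambda>n. (\<Sum>k<n. a n k (H \<omega>) * (w k (X \<omega>) - tr k (w k (X \<omega>)))) / real n) \<longlonglongrightarrow> 0"
    proof (rule Lim_null_comparison)
      show "\<forall>\<^sub>F n in sequentially.
          norm ((\<Sum>k<n. a n k (H \<omega>) * (w k (X \<omega>) - tr k (w k (X \<omega>)))) / real n) \<le> E / real n"
        using trunc by (intro always_eventually allI) (auto intro!: divide_right_mono)
      show "(\<lambda>n. E / real n) \<longlonglongrightarrow> 0"
        by (rule lim_const_over_n)
    qed
    moreover have "(\<lambda>n. (\<Sum>k<n. a n k (H \<omega>) * (m k - v)) / real n) \<longlonglongrightarrow> 0"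
    proof (rule Lim_null_comparison)
      show "\<forall>\<^sub>F n in sequentially. norm ((\<Sum>k<n. a n k (H \<omega>) * (m k - v)) / real n)
          \<le> K * \<kappa> * 2 * (1 / sqrt (real n))"
      proof (intro always_eventually allI)
        fix n
        have "norm ((\<Sum>k<n. a n k (H \<omega>) * (m k - v)) / real n) \<le> K * \<kappa> * 2 * sqrt (real n) / real n"
          using bias_sum by (auto intro!: divide_right_mono)
        also have "\<dots> = K * \<kappa> * 2 * (1 / sqrt (real n))"
          by (simp add: sqrt_divide_self_eq inverse_eq_divide flip: times_divide_eq_right)
        finally show "norm ((\<Sum>k<n. a n k (H \<omega>) * (m k - v)) / real n) \<le> K * \<kappa> * 2 * (1 / sqrt (real n))" .
      qed
      have "(\<lambda>n. 1 / sqrt (real n)) \<longlonglongrightarrow> 0"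
        by (intro tendsto_divide_0[OF tendsto_const] filterlim_at_top_imp_at_infinity filterlim_compose[OF sqrt_at_top] filterlim_real_sequentially)
      then show "(\<lambda>n. K * \<kappa> * 2 * (1 / sqrt (real n))) \<longlonglongrightarrow> 0"
        by (rule tendsto_mult_right_zero)
    qed
    ultimately have "(\<lambda>n. (\<Sum>k<n. a n k (H \<omega>) * x k \<omega>) / real n
        + (\<Sum>k<n. a n k (H \<omega>) * (w k (X \<omega>) - tr k (w k (X \<omega>)))) / real n
        + (\<Sum>k<n. a n k (H \<omega>) * (m k - v)) / real n) \<longlonglongrightarrow> 0 + 0 + 0"
      by (intro tendsto_add av)
    then show ?case
      by (simp add: x_def add_divide_distrib[symmetric] sum.distrib[symmetric] algebra_simps)
  qed
qed

end

lemma sum_symmetric_square: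
  fixes f :: "nat \<Rightarrow> nat \<Rightarrow> real"
  assumes "\<And>k l. k < n \<Longrightarrow> l < n \<Longrightarrow> f k l = f l k"
  shows "(\<Sum>k<n. \<Sum>l<n. f k l) = (\<Sum>k<n. f k k) + 2 * (\<Sum>l<n. \<Sum>k<l. f k l)"
  using assms
proof (induction n)
  case (Suc n)
  have "(\<Sum>k<Suc n. \<Sum>l<Suc n. f k l) = (\<Sum>k<n. \<Sum>l<n. f k l) + (\<Sum>k<n. f k n) + (\<Sum>l<n. f n l) + f n n"
    by (simp add: sum.distrib)
  also have "(\<Sum>l<n. f n l) = (\<Sum>k<n. f k n)"
    using Suc.prems by (intro sum.cong) auto
  finally show ?case
    using Suc by simp
qed simp

context independent_weights
begin

text \<open>
  The squares on the diagonal obey \<open>weighted_strong_law\<close>; the rest is a triangular form with $O(n^2)$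
  fourth moment.
\<close>
lemma quadratic_form_strong_law:
  fixes y :: "nat \<Rightarrow> 'b \<Rightarrow> real" and b :: "nat \<Rightarrow> nat \<Rightarrow> nat \<Rightarrow> 'c \<Rightarrow> real"
  assumes y_meas [measurable]: "\<And>k. y k \<in> borel_measurable N1"
    and b_meas [measurable]: "\<And>n k l. k < n \<Longrightarrow> l < n \<Longrightarrow> b n k l \<in> borel_measurable N2"
    and indep: "indep_vars (\<lambda>_. borel) (\<lambda>k \<omega>. y k (X \<omega>)) UNIV"
    and ident: "\<And>k. distr M borel (\<lambda>\<omega>. y k (X \<omega>)) = distr M borel (\<lambda>\<omega>. y 0 (X \<omega>))"
    and y4: "integrable M (\<lambda>\<omega>. y 0 (X \<omega>) ^ 4)"
    and mean: "expectation (\<lambda>\<omega>. y 0 (X \<omega>)) = 0"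
    and sym: "\<And>n k l \<omega>. k < n \<Longrightarrow> l < n \<Longrightarrow> \<omega> \<in> space M \<Longrightarrow> b n k l (H \<omega>) = b n l k (H \<omega>)"
    and col: "\<And>n l \<omega>. l < n \<Longrightarrow> \<omega> \<in> space M \<Longrightarrow> (\<Sum>k<n. b n k l (H \<omega>) ^ 2) \<le> K"
  defines "v \<equiv> expectation (\<lambda>\<omega>. y 0 (X \<omega>) ^ 2)"
  shows "AE \<omega> in M. (\<lambda>n. ((\<Sum>k<n. \<Sum>l<n. b n k l (H \<omega>) * (y k (X \<omega>) * y l (X \<omega>)))
      - v * (\<Sum>k<n. b n k k (H \<omega>))) / real n) \<longlonglongrightarrow> 0"
proof -
  define \<kappa> where "\<kappa> = expectation (\<lambda>\<omega>. y 0 (X \<omega>) ^ 4)"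
  have law: "expectation (\<lambda>\<omega>. f (y k (X \<omega>))) = expectation (\<lambda>\<omega>. f (y 0 (X \<omega>)))"
    and law_int: "integrable M (\<lambda>\<omega>. f (y k (X \<omega>))) \<longleftrightarrow> integrable M (\<lambda>\<omega>. f (y 0 (X \<omega>)))"
    if "f \<in> borel_measurable borel" for f :: "real \<Rightarrow> real" and k
    using expectation_ident_distr[OF _ _ ident that] by auto
  have diag: "AE \<omega> in M. (\<lambda>n. (\<Sum>k<n. b n k k (H \<omega>) * (y k (X \<omega>) ^ 2 - v)) / real n) \<longlonglongrightarrow> 0"
    unfolding v_def
  proof (rule weighted_strong_law[where K = "sqrt K"])
    show "indep_vars (\<lambda>_. borel) (\<lambda>k \<omega>. y k (X \<omega>) ^ 2) UNIV"
      by (rule indep_vars_compose2[OF indep]) auto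
    show "distr M borel (\<lambda>\<omega>. y k (X \<omega>) ^ 2) = distr M borel (\<lambda>\<omega>. y 0 (X \<omega>) ^ 2)" for k
    proof -
      have "distr M borel (\<lambda>\<omega>. y j (X \<omega>) ^ 2) = distr (distr M borel (\<lambda>\<omega>. y j (X \<omega>))) borel (\<lambda>x. x ^ 2)" for j
        by (subst distr_distr) (auto simp: comp_def)
      then show ?thesis using ident[of k] by simp
    qed
    show "integrable M (\<lambda>\<omega>. (y 0 (X \<omega>) ^ 2) ^ 2)"
      using y4 by (simp add: power_mult[symmetric])
    show "\<bar>b n k k (H \<omega>)\<bar> \<le> sqrt K" if "k < n" "\<omega> \<in> space M" for n k \<omega>
    proof (rule real_le_rsqrt)
      have "b n k k (H \<omega>) ^ 2 \<le> (\<Sum>j<n. b n j k (H \<omega>) ^ 2)"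
        using that by (intro member_le_sum[where f = "\<lambda>j. b n j k (H \<omega>) ^ 2"]) auto
      also have "\<dots> \<le> K"
        using that by (rule col)
      finally show "\<bar>b n k k (H \<omega>)\<bar>\<^sup>2 \<le> K" by simp
    qed
  qed auto
  define C where "C = (4 * v * (4 * v + 1) + 3 * \<kappa>) * (4 * v\<^sup>2 + 3 * \<kappa>) * (4 * K)\<^sup>2"
  have offdiag: "AE \<omega> in M. (\<lambda>n. (\<Sum>l<n. y l (X \<omega>) * (\<Sum>k<l. 2 * b n k l (H \<omega>) * y k (X \<omega>))) / real n) \<longlonglongrightarrow> 0"
  proof (rule AE_tendsto_0_of_fourth_moments)
    fix n
    have [measurable]: "(\<lambda>z. b n k l (snd z)) \<in> borel_measurable (N1 \<Otimes>\<^sub>M N2)"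
        "(\<lambda>\<omega>. b n k l (H \<omega>)) \<in> borel_measurable M" if "k < l" "l < n" for k l
      using that less_trans[OF that] by measurable
    show "(\<lambda>\<omega>. \<Sum>l<n. y l (X \<omega>) * (\<Sum>k<l. 2 * b n k l (H \<omega>) * y k (X \<omega>))) \<in> borel_measurable M"
      by (intro borel_measurable_sum borel_measurable_times) auto
    let ?f = "\<lambda>z. ennreal ((\<Sum>l<n. y l (fst z) * (\<Sum>k<l. 2 * b n k l (snd z) * y k (fst z))) ^ 4)"
    have "(\<integral>\<^sup>+\<omega>. ?f (X \<omega>, H \<omega>) \<partial>M) \<le> ennreal (C * (real n)\<^sup>2)"
    proof (rule nn_integral_bound_of_indep[OF X_measurable H_measurable joint_law])
      show "?f \<in> borel_measurable (N1 \<Otimes>\<^sub>M N2)"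
        by (intro measurable_compose[OF _ measurable_ennreal] borel_measurable_power
            borel_measurable_sum borel_measurable_times) auto
      fix \<omega>' assume \<omega>': "\<omega>' \<in> space M"
      have int4: "integrable M (\<lambda>\<omega>. y k (X \<omega>) ^ 4)" for k
        using law_int[of "\<lambda>x. x ^ 4" k] y4 by simp
      have mean': "expectation (\<lambda>\<omega>. y k (X \<omega>)) = 0" for k
        using law[of "\<lambda>x. x" k] mean by simp
      have vk: "expectation (\<lambda>\<omega>. y k (X \<omega>) ^ 2) \<le> v" and \<kappa>k: "expectation (\<lambda>\<omega>. y k (X \<omega>) ^ 4) \<le> \<kappa>" for k
        using law[of "\<lambda>x. x ^ 2" k] law[of "\<lambda>x. x ^ 4" k] by (simp_all add: v_def \<kappa>_def)
      have e: "(\<Sum>k<l. (2 * b n k l (H \<omega>')) ^ 2) \<le> 4 * K" if "l < n" for l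
      proof -
        have "(\<Sum>k<l. (2 * b n k l (H \<omega>')) ^ 2) \<le> (\<Sum>k<n. (2 * b n k l (H \<omega>')) ^ 2)"
          using that by (intro sum_mono2) auto
        also have "\<dots> = 4 * (\<Sum>k<n. b n k l (H \<omega>') ^ 2)"
          by (simp add: power_mult_distrib sum_distrib_left)
        finally show ?thesis
          using col[OF that \<omega>'] by simp
      qed
      note quad = triangular_quadratic_form_fourth_moment[OF indep int4 mean' vk \<kappa>k,
          where c = "\<lambda>k l. 2 * b n k l (H \<omega>')", OF e]
      have "(\<integral>\<^sup>+\<omega>. ?f (X \<omega>, H \<omega>') \<partial>M)
          = ennreal (expectation (\<lambda>\<omega>. (\<Sum>l<n. y l (X \<omega>) * (\<Sum>k<l. 2 * b n k l (H \<omega>') * y k (X \<omega>))) ^ 4))"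
        using quad(1) by (simp add: nn_integral_eq_integral)
      also have "\<dots> \<le> ennreal (C * (real n)\<^sup>2)"
        using quad(2) by (intro ennreal_leI) (simp add: C_def)
      finally show "(\<integral>\<^sup>+\<omega>. ?f (X \<omega>, H \<omega>') \<partial>M) \<le> ennreal (C * (real n)\<^sup>2)" .
    qed
    then show "(\<integral>\<^sup>+\<omega>. ennreal ((\<Sum>l<n. y l (X \<omega>) * (\<Sum>k<l. 2 * b n k l (H \<omega>) * y k (X \<omega>))) ^ 4) \<partial>M)
        \<le> ennreal (C * (real n)\<^sup>2)"
      by simp
  qed
  have "AE \<omega> in M. \<omega> \<in> space M"
    by simp
  with diag offdiag show ?thesis
  proof eventually_elim
    case (elim \<omega>)
    have "(\<Sum>k<n. \<Sum>l<n. b n k l (H \<omega>) * (y k (X \<omega>) * y l (X \<omega>))) - v * (\<Sum>k<n. b n k k (H \<omega>))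
        = (\<Sum>k<n. b n k k (H \<omega>) * (y k (X \<omega>) ^ 2 - v))
          + (\<Sum>l<n. y l (X \<omega>) * (\<Sum>k<l. 2 * b n k l (H \<omega>) * y k (X \<omega>)))" for n
    proof -
      have "(\<Sum>k<n. \<Sum>l<n. b n k l (H \<omega>) * (y k (X \<omega>) * y l (X \<omega>)))
          = (\<Sum>k<n. b n k k (H \<omega>) * (y k (X \<omega>) * y k (X \<omega>)))
            + 2 * (\<Sum>l<n. \<Sum>k<l. b n k l (H \<omega>) * (y k (X \<omega>) * y l (X \<omega>)))"
        using sym[OF _ _ elim(3)] by (intro sum_symmetric_square) (simp add: mult.commute)
      then show ?thesis
        by (simp add: sum_distrib_left right_diff_distrib sum_subtractf power2_eq_square mult_ac)
    qed
    then show ?case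
      using tendsto_add[OF elim(1,2)] by (simp add: add_divide_distrib)
  qed
qed

end

section \<open>The spiked array\<close>

context prob_space
begin

text \<open>
  Independence of the pairs and independence within each pair combine to independence of the doubly
  indexed family \<open>Z\<close>, whose two halves are the component sequences. In the product formula for finitely
  many members of \<open>Z\<close>, a pair of which only one component occurs is completed by the trivial event.
\<close>
lemma indep_component_sequences:
  fixes U V :: "nat \<Rightarrow> 'a \<Rightarrow> 'b"
  assumes pairs: "indep_vars (\<lambda>_. P \<Otimes>\<^sub>M Q) (\<lambda>j \<omega>. (U j \<omega>, V j \<omega>)) UNIV"
    and comps: "\<And>j. indep_var P (U j) Q (V j)"
  shows "indep_var (Pi\<^sub>M UNIV (\<lambda>_. P)) (\<lambda>\<omega> j. U j \<omega>) (Pi\<^sub>M UNIV (\<lambda>_. Q)) (\<lambda>\<omega> j. V j \<omega>)"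
proof -
  define N where "N z = (if snd z then P else Q)" for z :: "nat \<times> bool"
  define Z where "Z z = (if snd z then U (fst z) else V (fst z))" for z
  have U_meas [measurable]: "U j \<in> measurable M P" and V_meas [measurable]: "V j \<in> measurable M Q" for j
    using indep_var_rv1[OF comps] indep_var_rv2[OF comps] by auto
  have Z_meas: "Z z \<in> measurable M (N z)" for z
    unfolding Z_def N_def by simp
  have Z_indep: "indep_vars N Z UNIV"
    unfolding indep_vars_def2
  proof (intro conjI ballI Z_meas indep_setsI)
    show "{Z z -` A \<inter> space M |A. A \<in> sets (N z)} \<subseteq> events" for z
      by (auto intro: measurable_sets[OF Z_meas])
  next
    fix A and J :: "(nat \<times> bool) set"
    assume J: "J \<noteq> {}" "finite J" and "\<forall>z\<in>J. A z \<in> {Z z -` A \<inter> space M |A. A \<in> sets (N z)}"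
    then have "\<forall>z\<in>J. \<exists>S. S \<in> sets (N z) \<and> A z = Z z -` S \<inter> space M"
      by auto
    then obtain S where S: "\<And>z. z \<in> J \<Longrightarrow> S z \<in> sets (N z) \<and> A z = Z z -` S z \<inter> space M"
      by metis
    define S' where "S' z = (if z \<in> J then S z else space (N z))" for z
    have S': "S' z \<in> sets (N z)" for z
      using S by (auto simp: S'_def)
    then have S'T: "S' (j, True) \<in> sets P" and S'F: "S' (j, False) \<in> sets Q" for j
      using S'[of "(j, True)"] S'[of "(j, False)"] by (simp_all add: N_def)
    let ?J = "fst ` J"
    have trivial: "Z z -` S' z \<inter> space M = space M" if "z \<notin> J" for z
      using that measurable_space[OF Z_meas, of _ z] by (auto simp: S'_def)
    have inter: "(\<Inter>z\<in>J. A z)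
        = (\<Inter>j\<in>?J. (\<lambda>\<omega>. (U j \<omega>, V j \<omega>)) -` (S' (j, True) \<times> S' (j, False)) \<inter> space M)"
    proof -
      have eq: "(\<lambda>\<omega>. (U j \<omega>, V j \<omega>)) -` (S' (j, True) \<times> S' (j, False)) \<inter> space M
          = (Z (j, True) -` S' (j, True) \<inter> space M) \<inter> (Z (j, False) -` S' (j, False) \<inter> space M)" for j
        by (auto simp: Z_def)
      have "(\<Inter>z\<in>J. A z) = (\<Inter>z\<in>J. Z z -` S' z \<inter> space M)"
        using S by (auto simp: S'_def)
      also have "\<dots> = (\<Inter>z\<in>?J \<times> (UNIV :: bool set). Z z -` S' z \<inter> space M)"
      proof (rule Set.set_eqI)
        fix \<omega>
        have "(\<forall>z\<in>J. \<omega> \<in> Z z -` S' z \<inter> space M) \<longleftrightarrow> (\<forall>z\<in>?J \<times> (UNIV :: bool set). \<omega> \<in> Z z -` S' z \<inter> space M)"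
        proof (intro iffI ballI)
          fix z assume all: "\<forall>z\<in>J. \<omega> \<in> Z z -` S' z \<inter> space M" and "z \<in> ?J \<times> (UNIV :: bool set)"
          then have "\<omega> \<in> space M" using J by auto
          then show "\<omega> \<in> Z z -` S' z \<inter> space M"
            using all trivial[of z] by (cases "z \<in> J") auto
        next
          fix z assume "\<forall>z\<in>?J \<times> (UNIV :: bool set). \<omega> \<in> Z z -` S' z \<inter> space M" and "z \<in> J"
          then show "\<omega> \<in> Z z -` S' z \<inter> space M"
            by (cases z) (force dest!: bspec[of _ _ z])
        qed
        then show "\<omega> \<in> (\<Inter>z\<in>J. Z z -` S' z \<inter> space M) \<longleftrightarrow> \<omega> \<in> (\<Inter>z\<in>?J \<times> (UNIV :: bool set). Z z -` S' z \<inter> space M)"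
          by blast
      qed
      also have "\<dots> = (\<Inter>j\<in>?J. (Z (j, True) -` S' (j, True) \<inter> space M) \<inter> (Z (j, False) -` S' (j, False) \<inter> space M))"
        by (auto simp: UNIV_bool)
      finally show ?thesis
        unfolding eq .
    qed
    have "prob (\<Inter>z\<in>J. A z)
        = (\<Prod>j\<in>?J. prob ((\<lambda>\<omega>. (U j \<omega>, V j \<omega>)) -` (S' (j, True) \<times> S' (j, False)) \<inter> space M))"
      unfolding inter using J S'T S'F by (intro indep_varsD[OF pairs]) auto
    also have "\<dots> = (\<Prod>j\<in>?J. prob (U j -` S' (j, True) \<inter> space M) * prob (V j -` S' (j, False) \<inter> space M))"
      by (intro prod.cong refl indep_varD[OF comps] S'T S'F)
    also have "\<dots> = (\<Prod>j\<in>?J. \<Prod>c\<in>UNIV. prob (Z (j, c) -` S' (j, c) \<inter> space M))"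
      by (simp add: UNIV_bool Z_def mult.commute)
    also have "\<dots> = (\<Prod>z\<in>?J \<times> (UNIV :: bool set). prob (Z z -` S' z \<inter> space M))"
      by (simp add: prod.cartesian_product split_def)
    also have "\<dots> = (\<Prod>z\<in>J. prob (Z z -` S' z \<inter> space M))"
    proof (rule prod.mono_neutral_right)
      show "J \<subseteq> ?J \<times> UNIV" by force
      show "\<forall>z\<in>?J \<times> (UNIV :: bool set) - J. prob (Z z -` S' z \<inter> space M) = 1"
        using trivial by (auto simp: prob_space)
    qed (use J in auto)
    also have "\<dots> = (\<Prod>z\<in>J. prob (A z))"
      using S by (intro prod.cong) (auto simp: S'_def)
    finally show "prob (\<Inter>z\<in>J. A z) = (\<Prod>z\<in>J. prob (A z))" .
  qed
  let ?T = "UNIV \<times> {True}" and ?F = "UNIV \<times> {False}"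
  have "indep_var (Pi\<^sub>M UNIV (\<lambda>_. P)) ((\<lambda>u j. u (j, True)) \<circ> (\<lambda>\<omega>. restrict (\<lambda>z. Z z \<omega>) ?T))
      (Pi\<^sub>M UNIV (\<lambda>_. Q)) ((\<lambda>u j. u (j, False)) \<circ> (\<lambda>\<omega>. restrict (\<lambda>z. Z z \<omega>) ?F))"
  proof (rule indep_var_compose[OF indep_var_restrict[OF Z_indep]])
    have "(\<lambda>u. u (j, True)) \<in> measurable (Pi\<^sub>M ?T N) P" for j
      using measurable_component_singleton[of "(j, True)" ?T N] by (simp add: N_def)
    then show "(\<lambda>u j. u (j, True)) \<in> measurable (Pi\<^sub>M ?T N) (Pi\<^sub>M UNIV (\<lambda>_. P))"
      by (intro measurable_PiM_single') (auto simp: space_PiM N_def PiE_iff)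
    have "(\<lambda>u. u (j, False)) \<in> measurable (Pi\<^sub>M ?F N) Q" for j
      using measurable_component_singleton[of "(j, False)" ?F N] by (simp add: N_def)
    then show "(\<lambda>u j. u (j, False)) \<in> measurable (Pi\<^sub>M ?F N) (Pi\<^sub>M UNIV (\<lambda>_. Q))"
      by (intro measurable_PiM_single') (auto simp: space_PiM N_def PiE_iff)
  qed auto
  then show ?thesis
    by (simp add: comp_def Z_def)
qed

end

context spiked_array
begin

abbreviation "xi_space \<equiv> Pi\<^sub>M {..<m} (\<lambda>_. borel :: real measure)"
abbreviation "eta_space \<equiv> Pi\<^sub>M (UNIV :: nat set) (\<lambda>_. borel :: real measure)"

lemma column_measurable [measurable]:
  "\<xi> j \<in> measurable M xi_space" "\<eta> j \<in> measurable M eta_space"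
proof -
  have "(\<lambda>\<omega>. (\<xi> j \<omega>, \<eta> j \<omega>)) \<in> measurable M (xi_space \<Otimes>\<^sub>M eta_space)"
    using columns_indep by (auto simp: indep_vars_def)
  from measurable_compose[OF this measurable_fst] measurable_compose[OF this measurable_snd]
  show "\<xi> j \<in> measurable M xi_space" "\<eta> j \<in> measurable M eta_space"
    by simp_all
qed

lemma column_ident:
  "distr M xi_space (\<xi> j) = distr M xi_space (\<xi> 0)"
  "distr M eta_space (\<eta> j) = distr M eta_space (\<eta> 0)"
proof -
  let ?D = "\<lambda>j. distr M (xi_space \<Otimes>\<^sub>M eta_space) (\<lambda>\<omega>. (\<xi> j \<omega>, \<eta> j \<omega>))"
  have "distr M xi_space (\<xi> j) = distr (?D j) xi_space fst"
    and "distr M eta_space (\<eta> j) = distr (?D j) eta_space snd" for j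
    by (simp_all add: distr_distr comp_def)
  then show "distr M xi_space (\<xi> j) = distr M xi_space (\<xi> 0)"
    and "distr M eta_space (\<eta> j) = distr M eta_space (\<eta> 0)"
    using columns_ident[of j] by simp_all
qed

lemma column_xi_eta_indep: "indep_var xi_space (\<xi> j) eta_space (\<eta> j)"
  using xi_eta_indep unfolding indep_var_distribution_eq
  by (simp add: column_ident[of j] columns_ident[of j])

sublocale weights: independent_weights M "\<lambda>\<omega> j. \<xi> j \<omega>" "\<lambda>\<omega> j. \<eta> j \<omega>"
  "Pi\<^sub>M UNIV (\<lambda>_. xi_space)" "Pi\<^sub>M UNIV (\<lambda>_. eta_space)"
  using indep_component_sequences[OF columns_indep column_xi_eta_indep]
  unfolding indep_var_distribution_eq
  by unfold_locales auto

lemma xi_component_measurable [measurable]: "i < m \<Longrightarrow> (\<lambda>\<omega>. \<xi> k \<omega> i) \<in> borel_measurable M"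
  by (rule measurable_compose[OF column_measurable(1) measurable_component_singleton]) simp

lemma xi_fourth_moment:
  assumes "i < m"
  shows "integrable M (\<lambda>\<omega>. \<xi> 0 \<omega> i ^ 4)"
proof (rule Bochner_Integration.integrable_bound)
  show "integrable M (\<lambda>\<omega>. 1 + \<bar>\<xi> 0 \<omega> i\<bar> powr (4 + \<delta>))"
    using xi_moment[OF assms] by simp
  have "x ^ 4 \<le> 1 + \<bar>x\<bar> powr (4 + \<delta>)" for x :: real
  proof (cases "\<bar>x\<bar> \<le> 1")
    case True
    then have "x ^ 4 \<le> 1"
      using power_le_one[of "\<bar>x\<bar>" 4] by (simp add: power_even_abs)
    then show ?thesis by (simp add: add_increasing2)
  next
    case False
    then have "x ^ 4 = \<bar>x\<bar> powr 4"
      using powr_realpow[of "\<bar>x\<bar>" 4] by (simp add: power_even_abs)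
    also have "\<dots> \<le> \<bar>x\<bar> powr (4 + \<delta>)"
      using False delta_pos by (intro powr_mono) auto
    finally show ?thesis by simp
  qed
  then show "AE \<omega> in M. norm (\<xi> 0 \<omega> i ^ 4) \<le> norm (1 + \<bar>\<xi> 0 \<omega> i\<bar> powr (4 + \<delta>))"
    by (intro always_eventually allI) (auto simp: abs_of_nonneg intro: order_trans)
qed (use assms in measurable)

lemma xi_product_integrable:
  assumes "i < m" "j < m" "a + c \<le> 4"
  shows "integrable M (\<lambda>\<omega>. \<xi> 0 \<omega> i ^ a * \<xi> 0 \<omega> j ^ c)"
  using assms by (intro integrable_monomial_of_fourth xi_fourth_moment) auto

text \<open>
  Polarisation: with $a_k = \xi_{ki}$ and $c_k = \xi_{kj}$, the quadratic forms of $a + c$ and $a - c$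
  differ by four times the bilinear form, as the weights are symmetric, and the variances of
  $\xi_{0i} \pm \xi_{0j}$ differ by four times the covariance.
\<close>
lemma bilinear_form_strong_law:
  fixes b :: "nat \<Rightarrow> nat \<Rightarrow> nat \<Rightarrow> (nat \<Rightarrow> nat \<Rightarrow> real) \<Rightarrow> real"
  assumes b_meas: "\<And>n k l. k < n \<Longrightarrow> l < n \<Longrightarrow> b n k l \<in> borel_measurable (Pi\<^sub>M UNIV (\<lambda>_. eta_space))"
    and sym: "\<And>n k l \<omega>. k < n \<Longrightarrow> l < n \<Longrightarrow> \<omega> \<in> space M \<Longrightarrow> b n k l (\<lambda>j. \<eta> j \<omega>) = b n l k (\<lambda>j. \<eta> j \<omega>)"
    and col: "\<And>n l \<omega>. l < n \<Longrightarrow> \<omega> \<in> space M \<Longrightarrow> (\<Sum>k<n. b n k l (\<lambda>j. \<eta> j \<omega>) ^ 2) \<le> K"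
    and i: "i < m" and j: "j < m"
  shows "AE \<omega> in M. (\<lambda>n. ((\<Sum>k<n. \<Sum>l<n. b n k l (\<lambda>j. \<eta> j \<omega>) * (\<xi> k \<omega> i * \<xi> l \<omega> j))
    - expectation (\<lambda>\<omega>. \<xi> 0 \<omega> i * \<xi> 0 \<omega> j) * (\<Sum>k<n. b n k k (\<lambda>j. \<eta> j \<omega>))) / real n) \<longlonglongrightarrow> 0"
proof -
  define v where "v s = expectation (\<lambda>\<omega>. (\<xi> 0 \<omega> i + s * \<xi> 0 \<omega> j) ^ 2)" for s
  define q where "q s n \<omega> = (\<Sum>k<n. \<Sum>l<n. b n k l (\<lambda>j. \<eta> j \<omega>)
      * ((\<xi> k \<omega> i + s * \<xi> k \<omega> j) * (\<xi> l \<omega> i + s * \<xi> l \<omega> j)))" for s n \<omega>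
  define t where "t n \<omega> = (\<Sum>k<n. b n k k (\<lambda>j. \<eta> j \<omega>))" for n \<omega>
  let ?c = "expectation (\<lambda>\<omega>. \<xi> 0 \<omega> i * \<xi> 0 \<omega> j)"
  note int = xi_product_integrable[OF i j]
  have component [measurable]: "(\<lambda>x. x i) \<in> borel_measurable xi_space" "(\<lambda>x. x j) \<in> borel_measurable xi_space"
    using i j by (auto intro!: measurable_component_singleton)
  have comb [measurable]: "(\<lambda>x. x i + s * x j) \<in> borel_measurable xi_space" for s
    by measurable
  have quad: "AE \<omega> in M. (\<lambda>n. (q s n \<omega> - v s * t n \<omega>) / real n) \<longlonglongrightarrow> 0" for s
    unfolding q_def v_def t_def
  proof (rule weights.quadratic_form_strong_law[where y = "\<lambda>k x. x k i + s * x k j", OF _ b_meas _ _ _ _ sym col])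
    show "(\<lambda>x. x k i + s * x k j) \<in> borel_measurable (Pi\<^sub>M UNIV (\<lambda>_. xi_space))" for k
      by (rule measurable_compose[OF _ comb, of "\<lambda>x. x k"]) simp
    show "indep_vars (\<lambda>_. borel) (\<lambda>k \<omega>. \<xi> k \<omega> i + s * \<xi> k \<omega> j) UNIV"
      using indep_vars_compose2[OF columns_indep, of "\<lambda>_ z. fst z i + s * fst z j" "\<lambda>_. borel"] by simp
    show "distr M borel (\<lambda>\<omega>. \<xi> k \<omega> i + s * \<xi> k \<omega> j) = distr M borel (\<lambda>\<omega>. \<xi> 0 \<omega> i + s * \<xi> 0 \<omega> j)" for k
    proof -
      have "distr M borel (\<lambda>\<omega>. \<xi> k \<omega> i + s * \<xi> k \<omega> j)
          = distr (distr M xi_space (\<xi> k)) borel (\<lambda>x. x i + s * x j)" for k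
        by (simp add: distr_distr comp_def)
      then show ?thesis using column_ident(1)[of k] by simp
    qed
    have "(\<xi> 0 \<omega> i + s * \<xi> 0 \<omega> j) ^ 4 = \<xi> 0 \<omega> i ^ 4 * \<xi> 0 \<omega> j ^ 0
        + 4 * s * (\<xi> 0 \<omega> i ^ 3 * \<xi> 0 \<omega> j ^ 1) + 6 * s ^ 2 * (\<xi> 0 \<omega> i ^ 2 * \<xi> 0 \<omega> j ^ 2)
        + 4 * s ^ 3 * (\<xi> 0 \<omega> i ^ 1 * \<xi> 0 \<omega> j ^ 3) + s ^ 4 * (\<xi> 0 \<omega> i ^ 0 * \<xi> 0 \<omega> j ^ 4)" for \<omega>
      by (simp add: algebra_simps power_numeral_reduce)
    then show "integrable M (\<lambda>\<omega>. (\<xi> 0 \<omega> i + s * \<xi> 0 \<omega> j) ^ 4)"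
      by (simp only:) (intro Bochner_Integration.integrable_add integrable_mult_right int, simp_all)
    show "expectation (\<lambda>\<omega>. \<xi> 0 \<omega> i + s * \<xi> 0 \<omega> j) = 0"
      using int[of 1 0] int[of 0 1] xi_mean[OF i] xi_mean[OF j] by simp
  qed
  have v_diff: "v 1 - v (- 1) = 4 * ?c"
  proof -
    have sq: "(\<xi> 0 \<omega> i + s * \<xi> 0 \<omega> j) ^ 2 = \<xi> 0 \<omega> i ^ 2 * \<xi> 0 \<omega> j ^ 0
        + 2 * s * (\<xi> 0 \<omega> i ^ 1 * \<xi> 0 \<omega> j ^ 1) + s ^ 2 * (\<xi> 0 \<omega> i ^ 0 * \<xi> 0 \<omega> j ^ 2)" for s \<omega>
      by (simp add: algebra_simps power_numeral_reduce)
    have "v s = expectation (\<lambda>\<omega>. \<xi> 0 \<omega> i ^ 2) + 2 * s * ?c + s ^ 2 * expectation (\<lambda>\<omega>. \<xi> 0 \<omega> j ^ 2)" for s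
      unfolding v_def sq using int[of 2 0] int[of 1 1] int[of 0 2] by simp
    then show ?thesis by simp
  qed
  have "AE \<omega> in M. \<omega> \<in> space M"
    by simp
  with quad[of 1] quad[of "- 1"] show ?thesis
  proof eventually_elim
    case (elim \<omega>)
    let ?b = "\<lambda>n k l. b n k l (\<lambda>j. \<eta> j \<omega>)"
    have "q 1 n \<omega> - q (- 1) n \<omega> = 4 * (\<Sum>k<n. \<Sum>l<n. ?b n k l * (\<xi> k \<omega> i * \<xi> l \<omega> j))" for n
    proof -
      have "(\<Sum>k<n. \<Sum>l<n. ?b n k l * (\<xi> k \<omega> j * \<xi> l \<omega> i)) = (\<Sum>l<n. \<Sum>k<n. ?b n k l * (\<xi> k \<omega> j * \<xi> l \<omega> i))"
        by (rule sum.swap)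
      also have "\<dots> = (\<Sum>l<n. \<Sum>k<n. ?b n l k * (\<xi> l \<omega> i * \<xi> k \<omega> j))"
        using sym[OF _ _ elim(3)] by (intro sum.cong) auto
      finally have swap: "(\<Sum>k<n. \<Sum>l<n. ?b n k l * (\<xi> k \<omega> j * \<xi> l \<omega> i))
          = (\<Sum>k<n. \<Sum>l<n. ?b n k l * (\<xi> k \<omega> i * \<xi> l \<omega> j))" .
      have "q 1 n \<omega> - q (- 1) n \<omega> = (\<Sum>k<n. \<Sum>l<n. 2 * (?b n k l * (\<xi> k \<omega> i * \<xi> l \<omega> j))
          + 2 * (?b n k l * (\<xi> k \<omega> j * \<xi> l \<omega> i)))"
        unfolding q_def sum_subtractf[symmetric] by (intro sum.cong refl) (simp add: algebra_simps)
      then show ?thesis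
        using swap by (simp add: sum.distrib sum_distrib_left[symmetric])
    qed
    then have "(q 1 n \<omega> - v 1 * t n \<omega>) / real n - (q (- 1) n \<omega> - v (- 1) * t n \<omega>) / real n
        = 4 * (((\<Sum>k<n. \<Sum>l<n. ?b n k l * (\<xi> k \<omega> i * \<xi> l \<omega> j)) - ?c * t n \<omega>) / real n)" for n
      using v_diff by (simp add: diff_divide_distrib[symmetric] algebra_simps)
    with tendsto_diff[OF elim(1,2)] have "(\<lambda>n. 4 * (((\<Sum>k<n. \<Sum>l<n. ?b n k l * (\<xi> k \<omega> i * \<xi> l \<omega> j)) - ?c * t n \<omega>) / real n)) \<longlonglongrightarrow> 4 * 0"
      by simp
    then show ?case
      unfolding t_def by (subst (asm) tendsto_mult_left_iff) simp_all
  qed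
qed

text \<open>
  The bilinear law with the identity matrix as weights.
\<close>
lemma row_norm_strong_law:
  assumes i: "i < m"
  shows "AE \<omega> in M. (\<lambda>n. (\<Sum>k<n. \<xi> k \<omega> i ^ 2) / real n) \<longlonglongrightarrow> expectation (\<lambda>\<omega>. \<xi> 0 \<omega> i ^ 2)"
proof -
  have "AE \<omega> in M. (\<lambda>n. ((\<Sum>k<n. \<Sum>l<n. (if k = l then 1 else 0) * (\<xi> k \<omega> i * \<xi> l \<omega> i))
    - expectation (\<lambda>\<omega>. \<xi> 0 \<omega> i * \<xi> 0 \<omega> i) * (\<Sum>k<n. if k = k then 1 else 0)) / real n) \<longlonglongrightarrow> 0"
    by (rule bilinear_form_strong_law[where K = 1, OF _ _ _ i i]) (auto simp: if_distrib[of "\<lambda>x. x ^ 2"] cong: if_cong)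
  then show ?thesis
  proof eventually_elim
    case (elim \<omega>)
    have "(\<Sum>k<n. \<Sum>l<n. (if k = l then 1 else 0) * (\<xi> k \<omega> i * \<xi> l \<omega> i)) = (\<Sum>k<n. \<xi> k \<omega> i ^ 2)" for n
      by (intro sum.cong refl) (simp add: if_distrib[of "\<lambda>c. c * _"] power2_eq_square cong: if_cong)
    then have *: "(\<lambda>n. (\<Sum>k<n. \<xi> k \<omega> i ^ 2) / real n - expectation (\<lambda>\<omega>. \<xi> 0 \<omega> i ^ 2) * (real n / real n)) \<longlonglongrightarrow> 0"
      using elim by (simp add: diff_divide_distrib power2_eq_square if_distrib[of "\<lambda>x. _ * x"] cong: if_cong)
    have "(\<lambda>n. real n / real n) \<longlonglongrightarrow> 1"
      by (rule tendsto_eventually) (auto intro: eventually_sequentiallyI[of 1])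
    from tendsto_add[OF * tendsto_mult_left[OF this, of "expectation (\<lambda>\<omega>. \<xi> 0 \<omega> i ^ 2)"]]
    show ?case by simp
  qed
qed

end

section \<open>Entries and norms of the matrices\<close>

lemma mult_unit_vec:
  fixes A :: "real mat"
  assumes "A \<in> carrier_mat n n'" "l < n'"
  shows "A *\<^sub>v unit_vec n' l = col A l"
  using assms by (intro eq_vecI) (auto simp: scalar_prod_right_unit)

text \<open>
  A column is the image of a unit vector. The supremum in \<open>spectral_norm\<close> is known to be at
  least the value at that vector once the set of values is bounded; a crude entrywise bound gives this.
\<close>
lemma column_norm_le_spectral_norm:
  assumes A: "A \<in> carrier_mat n n'" and l: "l < n'"
  shows "sqrt (\<Sum>k<n. (A $$ (k, l)) ^ 2) \<le> spectral_norm A"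
proof -
  let ?V = "{v \<in> carrier_vec (dim_col A). euclid_norm v \<le> 1}"
  have sq: "scalar_prod v v = (\<Sum>k<dim_vec v. (v $ k) ^ 2)" for v :: "real vec"
    by (simp add: scalar_prod_def power2_eq_square atLeast0LessThan)
  have sum_sq: "euclid_norm v = sqrt (\<Sum>k<dim_vec v. (v $ k) ^ 2)" for v
    by (simp add: euclid_norm_def sq)
  define R where "R = sqrt (\<Sum>k<n. (\<Sum>j<n'. \<bar>A $$ (k, j)\<bar>) ^ 2)"
  have "bdd_above ((\<lambda>v. euclid_norm (A *\<^sub>v v)) ` ?V)"
  proof (rule bdd_aboveI2)
    fix v assume v: "v \<in> ?V"
    then have dim: "dim_vec v = n'" and norm: "(\<Sum>j<n'. (v $ j) ^ 2) \<le> 1"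
      using A by (auto simp: sum_sq)
    have coord: "\<bar>v $ j\<bar> \<le> 1" if "j < n'" for j
    proof -
      have "(v $ j) ^ 2 \<le> (\<Sum>j<n'. (v $ j) ^ 2)"
        using that by (intro member_le_sum) auto
      then have "(v $ j) ^ 2 \<le> 1" using norm by simp
      then show ?thesis by (simp add: abs_square_le_1)
    qed
    have "\<bar>(A *\<^sub>v v) $ k\<bar> \<le> (\<Sum>j<n'. \<bar>A $$ (k, j)\<bar>)" if "k < n" for k
    proof -
      have "(A *\<^sub>v v) $ k = (\<Sum>j<n'. A $$ (k, j) * v $ j)"
        using A that dim by (auto simp: scalar_prod_def atLeast0LessThan intro!: sum.cong)
      also have "\<bar>\<dots>\<bar> \<le> (\<Sum>j<n'. \<bar>A $$ (k, j)\<bar> * 1)"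
        using coord by (intro order_trans[OF sum_abs] sum_mono) (auto simp: abs_mult intro!: mult_left_le)
      finally show ?thesis by simp
    qed
    then have "((A *\<^sub>v v) $ k) ^ 2 \<le> (\<Sum>j<n'. \<bar>A $$ (k, j)\<bar>) ^ 2" if "k < n" for k
      using that power_mono[of "\<bar>(A *\<^sub>v v) $ k\<bar>" _ 2] by simp
    then show "euclid_norm (A *\<^sub>v v) \<le> R"
      using A unfolding sum_sq R_def
      by (intro real_sqrt_le_mono) (simp del: index_mult_mat_vec, intro sum_mono, simp del: index_mult_mat_vec)
  qed
  moreover have "unit_vec n' l \<in> ?V"
    using A l by (simp add: euclid_norm_def)
  ultimately have "euclid_norm (A *\<^sub>v unit_vec n' l) \<le> spectral_norm A"
    unfolding spectral_norm_def by (intro cSUP_upper)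
  moreover have "A *\<^sub>v unit_vec n' l = col A l"
    using A l by (rule mult_unit_vec)
  ultimately show ?thesis
    using A l by (simp add: sum_sq)
qed

lemma mult_entry:
  fixes A B :: "real mat"
  assumes "A \<in> carrier_mat r s" "B \<in> carrier_mat s t" "i < r" "j < t"
  shows "(A * B) $$ (i, j) = (\<Sum>k<s. A $$ (i, k) * B $$ (k, j))"
  using assms by (simp add: scalar_prod_def atLeast0LessThan)

lemma normalized_rows_carrier: "X \<in> carrier_mat r n \<Longrightarrow> normalized_rows X \<in> carrier_mat r n"
  by (auto simp: normalized_rows_def diag_inv_sqrt_def diag_part_def)

lemma sum_Kronecker:
  fixes f :: "nat \<Rightarrow> real"
  assumes "i < r"
  shows "(\<Sum>k<r. (if i = k then a else 0) * f k) = a * f i"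
    and "(\<Sum>k<r. f k * (if k = i then a else 0)) = f i * a"
  using assms by (simp_all add: if_distrib[of "\<lambda>x. x * _"] if_distrib[of "\<lambda>x. _ * x"] cong: if_cong)

lemma normalized_rows_entry:
  assumes X: "X \<in> carrier_mat r n" and "i < r" "k < n"
  shows "normalized_rows X $$ (i, k) = X $$ (i, k) / sqrt ((\<Sum>l<n. (X $$ (i, l)) ^ 2) / real n)"
proof -
  let ?D = "diag_inv_sqrt (diag_part ((1 / real (dim_col X)) \<cdot>\<^sub>m (X * transpose_mat X)))"
  have entry: "((1 / real (dim_col X)) \<cdot>\<^sub>m (X * transpose_mat X)) $$ (i, i) = (\<Sum>l<n. (X $$ (i, l)) ^ 2) / real n"
    using assms by (simp add: scalar_prod_def power2_eq_square atLeast0LessThan)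
  have D: "?D \<in> carrier_mat r r"
    using X by (auto simp: diag_inv_sqrt_def diag_part_def)
  have "?D $$ (i, j) = (if i = j then 1 / sqrt ((\<Sum>l<n. (X $$ (i, l)) ^ 2) / real n) else 0)" if "j < r" for j
    using X assms that entry by (auto simp: diag_inv_sqrt_def diag_part_def)
  then have "(?D * X) $$ (i, k)
      = (\<Sum>j<r. (if i = j then 1 / sqrt ((\<Sum>l<n. (X $$ (i, l)) ^ 2) / real n) else 0) * X $$ (j, k))"
    unfolding mult_entry[OF D assms] by (intro sum.cong) auto
  also have "\<dots> = 1 / sqrt ((\<Sum>l<n. (X $$ (i, l)) ^ 2) / real n) * X $$ (i, k)"
    by (rule sum_Kronecker) fact
  finally show ?thesis
    by (simp add: normalized_rows_def)
qed

lemma sandwich_entry: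
  fixes Y B :: "real mat"
  assumes "Y \<in> carrier_mat r n" "B \<in> carrier_mat n n" "i < r" "j < r"
  shows "(Y * B * transpose_mat Y) $$ (i, j) = (\<Sum>k<n. \<Sum>l<n. Y $$ (i, k) * B $$ (k, l) * Y $$ (j, l))"
proof -
  have "(Y * B * transpose_mat Y) $$ (i, j) = (\<Sum>l<n. (\<Sum>k<n. Y $$ (i, k) * B $$ (k, l)) * Y $$ (j, l))"
    using assms mult_entry[OF mult_carrier_mat[OF assms(1,2)], of "transpose_mat Y" r i j]
    by (simp add: mult_entry[OF assms(1,2)] del: index_mult_mat)
  also have "\<dots> = (\<Sum>l<n. \<Sum>k<n. Y $$ (i, k) * B $$ (k, l) * Y $$ (j, l))"
    by (simp add: sum_distrib_right)
  also have "\<dots> = (\<Sum>k<n. \<Sum>l<n. Y $$ (i, k) * B $$ (k, l) * Y $$ (j, l))"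
    by (rule sum.swap)
  finally show ?thesis .
qed

lemma correlation_matrix_entry:
  assumes "i < m" "j < m"
  shows "correlation_matrix M m \<xi> $$ (i, j) = covariance_matrix M m \<xi> $$ (i, j)
    / (sqrt (covariance_matrix M m \<xi> $$ (i, i)) * sqrt (covariance_matrix M m \<xi> $$ (j, j)))"
proof -
  define C where "C = covariance_matrix M m \<xi>"
  have C: "C \<in> carrier_mat m m"
    by (simp add: C_def covariance_matrix_def)
  let ?D = "diag_inv_sqrt (diag_part C)"
  have D: "?D \<in> carrier_mat m m"
    using C by (auto simp: diag_inv_sqrt_def diag_part_def)
  have entry: "?D $$ (a, b) = (if a = b then 1 / sqrt (C $$ (a, a)) else 0)" if "a < m" "b < m" for a b
    using C that by (simp add: diag_inv_sqrt_def diag_part_def)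
  have left: "(?D * C) $$ (i, k) = 1 / sqrt (C $$ (i, i)) * C $$ (i, k)" if "k < m" for k
  proof -
    have "(?D * C) $$ (i, k) = (\<Sum>a<m. (if i = a then 1 / sqrt (C $$ (i, i)) else 0) * C $$ (a, k))"
      using assms that entry by (simp add: mult_entry[OF D C] del: index_mult_mat)
    then show ?thesis
      using sum_Kronecker(1)[OF assms(1)] by simp
  qed
  have "(?D * C * ?D) $$ (i, j)
      = (\<Sum>k<m. (1 / sqrt (C $$ (i, i)) * C $$ (i, k)) * (if k = j then 1 / sqrt (C $$ (j, j)) else 0))"
    by (subst mult_entry[OF mult_carrier_mat[OF D C] D assms]) (auto simp: left entry assms simp del: index_mult_mat intro!: sum.cong)
  also have "\<dots> = 1 / sqrt (C $$ (i, i)) * C $$ (i, j) * (1 / sqrt (C $$ (j, j)))"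
    by (rule sum_Kronecker) fact
  finally show ?thesis
    by (simp add: correlation_matrix_def Let_def C_def)
qed

lemma correlation_matrix_carrier: "correlation_matrix M m \<xi> \<in> carrier_mat m m"
  by (auto simp: correlation_matrix_def covariance_matrix_def diag_inv_sqrt_def diag_part_def Let_def)

context spiked_array
begin

lemma covariance_matrix_entry:
  assumes "i < m" "j < m"
  shows "covariance_matrix M m (\<xi> 0) $$ (i, j) = expectation (\<lambda>\<omega>. \<xi> 0 \<omega> i * \<xi> 0 \<omega> j)"
  using assms xi_mean by (simp add: covariance_matrix_def)

text \<open>
  A vanishing variance makes column \<open>i\<close> of the correlation matrix zero, so \<open>unit_vec m i\<close> is an
  eigenvector for the eigenvalue 0.
\<close>
lemma xi_variance_pos:
  assumes i: "i < m"
  shows "0 < expectation (\<lambda>\<omega>. \<xi> 0 \<omega> i * \<xi> 0 \<omega> i)"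
proof (rule ccontr)
  let ?G = "correlation_matrix M m (\<xi> 0)"
  assume "\<not> 0 < expectation (\<lambda>\<omega>. \<xi> 0 \<omega> i * \<xi> 0 \<omega> i)"
  moreover have "0 \<le> expectation (\<lambda>\<omega>. \<xi> 0 \<omega> i * \<xi> 0 \<omega> i)"
    by simp
  ultimately have "covariance_matrix M m (\<xi> 0) $$ (i, i) = 0"
    using covariance_matrix_entry[OF i i] by simp
  then have "?G *\<^sub>v unit_vec m i = 0 \<cdot>\<^sub>v unit_vec m i"
    using mult_unit_vec[OF correlation_matrix_carrier i] correlation_matrix_carrier[of M m "\<xi> 0"] i
    by (intro eq_vecI) (auto simp: correlation_matrix_entry)
  then have "eigenvector ?G (unit_vec m i) 0"
    using correlation_matrix_carrier[of M m "\<xi> 0"] unit_vec_nonzero[OF i]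
    by (auto simp: eigenvector_def)
  then have "eigenvalue ?G 0"
    unfolding eigenvalue_def by blast
  then show False
    using corr_eigenvalues_pos by force
qed

end

section \<open>Normalised bilinear forms\<close>

theorem lemma8:
  fixes M :: "'a measure"
    and m :: nat
    and \<delta> \<gamma> :: real
    and \<xi> \<eta> :: "nat \<Rightarrow> 'a \<Rightarrow> nat \<Rightarrow> real"
    and p :: "nat \<Rightarrow> nat"
    and B :: "nat \<Rightarrow> real mat \<Rightarrow> real mat"
  defines "X1 \<equiv> \<lambda>n \<omega>. normalized_rows (data_matrix \<xi> m n \<omega>)"
    and "X2 \<equiv> \<lambda>n \<omega>. normalized_rows (data_matrix \<eta> (p n) n \<omega>)"
    and "\<Gamma> \<equiv> correlation_matrix M m (\<xi> 0)"
  assumes model: "spiked_array M m \<delta> \<xi> \<eta>"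
    and p_inf: "filterlim p at_top sequentially"
    and ratio: "(\<lambda>n. real (p n) / real n) \<longlonglongrightarrow> \<gamma>"
    and gamma_pos: "\<gamma> > 0"
    and B_measurable: "\<And>n i j. i < n \<Longrightarrow> j < n \<Longrightarrow>
          (\<lambda>Y. B n (Matrix.mat (p n) n Y) $$ (i, j))
            \<in> borel_measurable (Pi\<^sub>M ({..<p n} \<times> {..<n}) (\<lambda>_. borel))"
    and B_symmetric: "\<And>n \<omega>. \<omega> \<in> space M \<Longrightarrow>
          B n (X2 n \<omega>) \<in> carrier_mat n n \<and> transpose_mat (B n (X2 n \<omega>)) = B n (X2 n \<omega>)"
    and B_bounded: "AE \<omega> in M. limsup (\<lambda>n. ereal (spectral_norm (B n (X2 n \<omega>)))) < \<infinity>"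
  shows "AE \<omega> in M. \<forall>i<m. \<forall>j<m.
    (\<lambda>n. ((1 / real n) \<cdot>\<^sub>m (X1 n \<omega> * B n (X2 n \<omega>) * transpose_mat (X1 n \<omega>))
           - (1 / real n * mat_trace (B n (X2 n \<omega>))) \<cdot>\<^sub>m \<Gamma>) $$ (i, j)) \<longlonglongrightarrow> 0"
proof -
  interpret spiked_array M m \<delta> \<xi> \<eta>
    by fact
  let ?env = "Pi\<^sub>M UNIV (\<lambda>_. eta_space)"
  define Bn where "Bn n h = B n (normalized_rows (Matrix.mat (p n) n (\<lambda>(i, j). h j i)))"
    for n and h :: "nat \<Rightarrow> nat \<Rightarrow> real"
  have B_eq: "B n (X2 n \<omega>) = Bn n (\<lambda>j. \<eta> j \<omega>)" for n \<omega>
    by (simp add: X2_def Bn_def data_matrix_def)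
  have Bn_carrier: "Bn n (\<lambda>j. \<eta> j \<omega>) \<in> carrier_mat n n"
    and Bn_sym: "k < n \<Longrightarrow> l < n \<Longrightarrow> Bn n (\<lambda>j. \<eta> j \<omega>) $$ (k, l) = Bn n (\<lambda>j. \<eta> j \<omega>) $$ (l, k)"
    if "\<omega> \<in> space M" for n \<omega> k l
    using B_symmetric[OF that, of n] index_transpose_mat(1)[of k "Bn n (\<lambda>j. \<eta> j \<omega>)" l]
    unfolding B_eq by (auto simp del: index_transpose_mat)
  (* B n is evaluated at a normalised data matrix, whose entries are measurable functions of h. *)
  have Bn_meas [measurable]: "(\<lambda>h. Bn n h $$ (k, l)) \<in> borel_measurable ?env" if "k < n" "l < n" for n k l
  proof -
    define Y where "Y h = (\<lambda>z\<in>{..<p n} \<times> {..<n}.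
        h (snd z) (fst z) / sqrt ((\<Sum>l<n. (h l (fst z)) ^ 2) / real n))" for h :: "nat \<Rightarrow> nat \<Rightarrow> real"
    have comp [measurable]: "(\<lambda>h. h j i) \<in> borel_measurable ?env" for i j :: nat
      by (rule measurable_compose[of "\<lambda>h. h j" _ eta_space "\<lambda>g. g i"]) auto
    have "Y \<in> measurable ?env (Pi\<^sub>M ({..<p n} \<times> {..<n}) (\<lambda>_. borel))"
      unfolding Y_def by (rule measurable_restrict) measurable
    then have "(\<lambda>h. B n (Matrix.mat (p n) n (Y h)) $$ (k, l)) \<in> borel_measurable ?env"
      by (rule measurable_compose[OF _ B_measurable[OF that]])
    moreover have "Matrix.mat (p n) n (Y h) = normalized_rows (Matrix.mat (p n) n (\<lambda>(i, j). h j i))" for h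
      using normalized_rows_carrier[of "Matrix.mat (p n) n (\<lambda>(i, j). h j i)" "p n" n]
      by (intro eq_matI) (auto simp: Y_def normalized_rows_entry[where r = "p n" and n = n])
    ultimately show ?thesis
      by (simp add: Bn_def)
  qed
  (* Cutting off by column sums rather than by the spectral norm keeps the measurability evident and
     preserves symmetry, as the condition concerns the whole matrix. *)
  define b where "b K n k l h = (if \<forall>l\<in>{..<n}. (\<Sum>k<n. (Bn n h $$ (k, l)) ^ 2) \<le> real K then Bn n h $$ (k, l) else 0)"
    for K n k l h
  have b_meas: "b K n k l \<in> borel_measurable ?env" if "k < n" "l < n" for K n k l
  proof -
    have [measurable]: "(\<lambda>h. \<Sum>k<n. (Bn n h $$ (k, l)) ^ 2) \<in> borel_measurable ?env" if "l < n" for l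
      using that by measurable
    show ?thesis
      unfolding b_def using that by (intro measurable_If pred_intros_finite) auto
  qed
  have b_col: "(\<Sum>k<n. b K n k l h ^ 2) \<le> real K" if "l < n" for K n l h
  proof (cases "\<forall>l\<in>{..<n}. (\<Sum>k<n. (Bn n h $$ (k, l)) ^ 2) \<le> real K")
    case True
    then show ?thesis
      unfolding b_def if_P[OF True] using that by blast
  next
    case False
    show ?thesis
      unfolding b_def if_not_P[OF False] by simp
  qed
  have bilin: "AE \<omega> in M. (\<lambda>n. ((\<Sum>k<n. \<Sum>l<n. b K n k l (\<lambda>j. \<eta> j \<omega>) * (\<xi> k \<omega> i * \<xi> l \<omega> j))
      - expectation (\<lambda>\<omega>. \<xi> 0 \<omega> i * \<xi> 0 \<omega> j) * (\<Sum>k<n. b K n k k (\<lambda>j. \<eta> j \<omega>))) / real n) \<longlonglongrightarrow> 0"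
    if "i < m" "j < m" for K i j
    by (rule bilinear_form_strong_law[where K = "real K", OF b_meas _ b_col that])
      (auto simp: b_def intro: Bn_sym)
  have all_bilin: "AE \<omega> in M. \<forall>K i j. i < m \<longrightarrow> j < m \<longrightarrow>
      (\<lambda>n. ((\<Sum>k<n. \<Sum>l<n. b K n k l (\<lambda>j. \<eta> j \<omega>) * (\<xi> k \<omega> i * \<xi> l \<omega> j))
      - expectation (\<lambda>\<omega>. \<xi> 0 \<omega> i * \<xi> 0 \<omega> j) * (\<Sum>k<n. b K n k k (\<lambda>j. \<eta> j \<omega>))) / real n) \<longlonglongrightarrow> 0"
    unfolding AE_all_countable using bilin by (intro allI AE_impI) auto
  have all_rows: "AE \<omega> in M. \<forall>i. i < m \<longrightarrow>
      (\<lambda>n. (\<Sum>k<n. \<xi> k \<omega> i ^ 2) / real n) \<longlonglongrightarrow> expectation (\<lambda>\<omega>. \<xi> 0 \<omega> i ^ 2)"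
    unfolding AE_all_countable using row_norm_strong_law by (intro allI AE_impI) auto
  have "AE \<omega> in M. \<omega> \<in> space M"
    by simp
  with all_bilin all_rows B_bounded show ?thesis
  proof eventually_elim
    case (elim \<omega>)
    note \<omega> = \<open>\<omega> \<in> space M\<close>
    let ?B = "\<lambda>n. Bn n (\<lambda>j. \<eta> j \<omega>)"
    obtain c :: nat where "limsup (\<lambda>n. ereal (spectral_norm (?B n))) < ereal (real c)"
      using elim(3) less_PInf_Ex_of_nat[of "limsup (\<lambda>n. ereal (spectral_norm (?B n)))"]
      unfolding B_eq by auto
    then have "\<forall>\<^sub>F n in sequentially. ereal (spectral_norm (?B n)) < ereal (real c)"
      by (rule Limsup_lessD)
    then have bounded: "\<forall>\<^sub>F n in sequentially. \<forall>l\<in>{..<n}. (\<Sum>k<n. (?B n $$ (k, l)) ^ 2) \<le> real (c\<^sup>2)"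
    proof eventually_elim
      case (elim n)
      show ?case
      proof
        fix l assume "l \<in> {..<n}"
        then have "sqrt (\<Sum>k<n. (?B n $$ (k, l)) ^ 2) \<le> real c"
          using column_norm_le_spectral_norm[OF Bn_carrier[OF \<omega>], of l n] elim by simp
        then show "(\<Sum>k<n. (?B n $$ (k, l)) ^ 2) \<le> real (c\<^sup>2)"
          using sqrt_le_D by fastforce
      qed
    qed
    show ?case
    proof (intro allI impI)
      fix i j assume i: "i < m" and j: "j < m"
      define \<sigma> where "\<sigma> i j = expectation (\<lambda>\<omega>. \<xi> 0 \<omega> i * \<xi> 0 \<omega> j)" for i j
      define s where "s i n = sqrt ((\<Sum>l<n. \<xi> l \<omega> i ^ 2) / real n)" for i n
      define A where "A n = (\<Sum>k<n. \<Sum>l<n. b (c\<^sup>2) n k l (\<lambda>j. \<eta> j \<omega>) * (\<xi> k \<omega> i * \<xi> l \<omega> j)) / real n" for n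
      define T where "T n = (\<Sum>k<n. b (c\<^sup>2) n k k (\<lambda>j. \<eta> j \<omega>)) / real n" for n
      have AT: "(\<lambda>n. A n - \<sigma> i j * T n) \<longlonglongrightarrow> 0"
        using elim(1) i j by (simp add: A_def T_def \<sigma>_def diff_divide_distrib)
      have s_lim: "s i \<longlonglongrightarrow> sqrt (\<sigma> i i)" if "i < m" for i
        using elim(2) that unfolding s_def \<sigma>_def
        by (auto intro!: tendsto_real_sqrt simp: power2_eq_square)
      have \<sigma>_pos: "0 < \<sigma> i i" if "i < m" for i
        using xi_variance_pos[OF that] by (simp add: \<sigma>_def)
      have T_bound: "norm (T n) \<le> c" for n
      proof -
        have "\<bar>b (c\<^sup>2) n k k (\<lambda>j. \<eta> j \<omega>)\<bar> \<le> real c" if "k < n" for k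
        proof (rule abs_le_square_iff[THEN iffD2, of _ "real c", simplified])
          have "b (c\<^sup>2) n k k (\<lambda>j. \<eta> j \<omega>) ^ 2 \<le> (\<Sum>l<n. b (c\<^sup>2) n l k (\<lambda>j. \<eta> j \<omega>) ^ 2)"
            using that by (intro member_le_sum[where f = "\<lambda>l. b (c\<^sup>2) n l k (\<lambda>j. \<eta> j \<omega>) ^ 2"]) auto
          also have "\<dots> \<le> real (c\<^sup>2)"
            using that by (rule b_col)
          finally show "b (c\<^sup>2) n k k (\<lambda>j. \<eta> j \<omega>) ^ 2 \<le> (real c)\<^sup>2" by simp
        qed
        then have "\<bar>\<Sum>k<n. b (c\<^sup>2) n k k (\<lambda>j. \<eta> j \<omega>)\<bar> \<le> (\<Sum>k<n. real c)"
          by (intro order_trans[OF sum_abs] sum_mono) auto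
        then show ?thesis
          by (cases "n = 0") (simp_all add: T_def field_simps)
      qed
      (* With T the normalised trace, the normalised entry minus its target is
         (A - \<sigma> T) r + \<sigma> T (r - r'), where T is bounded and r tends to r'. *)
      define r where "r n = 1 / (s i n * s j n)" for n
      define r' where "r' = 1 / (sqrt (\<sigma> i i) * sqrt (\<sigma> j j))"
      have r_lim: "r \<longlonglongrightarrow> r'"
        unfolding r_def r'_def using \<sigma>_pos[OF i] \<sigma>_pos[OF j]
        by (intro tendsto_intros s_lim i j) auto
      have "(\<lambda>n. T n * (r n - r')) \<longlonglongrightarrow> 0"
      proof (rule Lim_null_comparison)
        show "\<forall>\<^sub>F n in sequentially. norm (T n * (r n - r')) \<le> c * \<bar>r n - r'\<bar>"
          using T_bound by (intro always_eventually allI) (auto simp: abs_mult intro!: mult_right_mono)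
        have "(\<lambda>n. c * \<bar>r n - r'\<bar>) \<longlonglongrightarrow> c * \<bar>r' - r'\<bar>"
          by (intro tendsto_intros r_lim)
        then show "(\<lambda>n. c * \<bar>r n - r'\<bar>) \<longlonglongrightarrow> 0"
          by simp
      qed
      from tendsto_add[OF tendsto_mult[OF AT r_lim] tendsto_mult_left[OF this, of "\<sigma> i j"]]
      have lim: "(\<lambda>n. A n * r n - T n * (\<sigma> i j * r')) \<longlonglongrightarrow> 0"
        by (simp add: algebra_simps)
      have "\<forall>\<^sub>F n in sequentially. ((1 / real n) \<cdot>\<^sub>m (X1 n \<omega> * B n (X2 n \<omega>) * transpose_mat (X1 n \<omega>))
           - (1 / real n * mat_trace (B n (X2 n \<omega>))) \<cdot>\<^sub>m \<Gamma>) $$ (i, j) = A n * r n - T n * (\<sigma> i j * r')"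
        using bounded
      proof eventually_elim
        case (elim n)
        have b_eq: "b (c\<^sup>2) n k l (\<lambda>j. \<eta> j \<omega>) = ?B n $$ (k, l)" for k l
          using elim by (simp add: b_def)
        have data: "data_matrix \<xi> m n \<omega> \<in> carrier_mat m n"
          by (simp add: data_matrix_def)
        have X1_carrier: "X1 n \<omega> \<in> carrier_mat m n"
          unfolding X1_def by (rule normalized_rows_carrier[OF data])
        have X1_entry: "X1 n \<omega> $$ (i, k) = \<xi> k \<omega> i / s i n" if "i < m" "k < n" for i k
          using normalized_rows_entry[OF data that] that by (simp add: X1_def data_matrix_def s_def)
        have "(X1 n \<omega> * ?B n * transpose_mat (X1 n \<omega>)) $$ (i, j)
            = (\<Sum>k<n. \<Sum>l<n. X1 n \<omega> $$ (i, k) * ?B n $$ (k, l) * X1 n \<omega> $$ (j, l))"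
          by (rule sandwich_entry[OF X1_carrier Bn_carrier[OF \<omega>] i j])
        also have "\<dots> = (\<Sum>k<n. \<Sum>l<n. b (c\<^sup>2) n k l (\<lambda>j. \<eta> j \<omega>) * (\<xi> k \<omega> i * \<xi> l \<omega> j) * r n)"
          using i j by (intro sum.cong refl) (simp add: X1_entry b_eq r_def)
        finally have main: "1 / real n * (X1 n \<omega> * ?B n * transpose_mat (X1 n \<omega>)) $$ (i, j) = A n * r n"
          by (simp add: A_def sum_distrib_right)
        have trace: "1 / real n * mat_trace (?B n) = T n"
          using Bn_carrier[OF \<omega>, of n] by (simp add: mat_trace_def T_def b_eq)
        have \<Gamma>: "\<Gamma> $$ (i, j) = \<sigma> i j * r'"
          using i j by (simp add: \<Gamma>_def correlation_matrix_entry covariance_matrix_entry \<sigma>_def r'_def)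
        have \<Gamma>_carrier: "\<Gamma> \<in> carrier_mat m m"
          unfolding \<Gamma>_def by (rule correlation_matrix_carrier)
        have S_carrier: "X1 n \<omega> * ?B n * transpose_mat (X1 n \<omega>) \<in> carrier_mat m m"
          using X1_carrier Bn_carrier[OF \<omega>, of n] by simp
        have "(a \<cdot>\<^sub>m S - c \<cdot>\<^sub>m \<Gamma>) $$ (i, j) = a * S $$ (i, j) - c * \<Gamma> $$ (i, j)"
          if "S \<in> carrier_mat m m" for a c S
          using that \<Gamma>_carrier i j by simp
        from this[OF S_carrier, of "1 / real n" "1 / real n * mat_trace (?B n)"]
        show ?case
          unfolding B_eq main trace \<Gamma> .
      qed
      with lim show "(\<lambda>n. ((1 / real n) \<cdot>\<^sub>m (X1 n \<omega> * B n (X2 n \<omega>) * transpose_mat (X1 n \<omega>))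
           - (1 / real n * mat_trace (B n (X2 n \<omega>))) \<cdot>\<^sub>m \<Gamma>) $$ (i, j)) \<longlonglongrightarrow> 0"
        by (simp add: tendsto_cong)
    qed
  qed
qed

end
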